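(* Let $\mu$ be a Borel probability measure on $\mathbb{R}$ and, for each $N$, let $\mu^{(N)}$ be a probability measure on $S^{N-1}(\sqrt N)$, such that $\{\mu^{(N)}\}_{N\in\mathbb{N}}$ is $\mu$-chaotic. Then $$H(\mu|\gamma)\le\liminf_{N\to\infty}\frac{H(\mu^{(N)}|\sigma^N)}{N}.$$
   Context: $S^{N-1}(\sqrt N)\subset\mathbb{R}^N$ is the sphere of radius $\sqrt N$ centred at $0$, and $\sigma^N$ is the uniform probability measure on it. $\gamma(v)=e^{-v^2/2}/\sqrt{2\pi}$, identified with the measure $\gamma(v)\,dv$. For probability measures $\mu,\nu$ on the same space, $H(\mu|\nu)=\int h\log h\,d\nu$ with $h=d\mu/d\nu$, and $H(\mu|\nu)=+\infty$ if $\mu$ is not absolutely continuous with respect to $\nu$. Chaos: $\{\mu^{(N)}\}_{N\in\mathbb N}$ is $\mu$-chaotic if (i) each $\mu^{(N)}$ is symmetric under interchange of the variables $v_1,\dots,v_N$; and (ii) for each fixed positive integer $k$, the marginal $P_k\mu^{(N)}$ of $\mu^{(N)}$ on the first $k$ coordinates $(v_1,\dots,v_k)$ converges, as $N\to\infty$, to $\mu^{\otimes k}$ weakly against bounded continuous test functions on $\mathbb{R}^k$. *)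

theory Defs
  imports "HOL-Probability.Probability"
begin

section \<open>Euclidean space with a varying dimension\<close>

text \<open>
  A point of $R^n$ is a function on the index set \<open>{..<n}\<close> (with value \<open>undefined\<close> elsewhere),
  so that the coordinates $v_1, \dots, v_n$ are \<open>v 0, \<dots>, v (n - 1)\<close>. The Borel sets of $R^n$ are
  those of \<open>borel_Rn n\<close>, its topology is \<open>powertop_real {..<n}\<close>, and the Euclidean norm is
  \<open>L2_set v {..<n}\<close>.
\<close>

definition borel_Rn :: "nat \<Rightarrow> (nat \<Rightarrow> real) measure" where
  "borel_Rn n = (\<Pi>\<^sub>M i\<in>{..<n}. borel)"

definition lborel_Rn :: "nat \<Rightarrow> (nat \<Rightarrow> real) measure" where
  "lborel_Rn n = (\<Pi>\<^sub>M i\<in>{..<n}. lborel)"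

definition unit_ball_Rn :: "nat \<Rightarrow> (nat \<Rightarrow> real) set" where
  "unit_ball_Rn n = {v \<in> space (borel_Rn n). L2_set v {..<n} \<le> 1}"


section \<open>The sphere of radius $\sqrt N$ and its uniform distribution\<close>

definition kac_sphere :: "nat \<Rightarrow> (nat \<Rightarrow> real) set" where
  "kac_sphere N = {v \<in> space (borel_Rn N). L2_set v {..<N} = sqrt (real N)}"

definition borel_kac_sphere :: "nat \<Rightarrow> (nat \<Rightarrow> real) measure" where
  "borel_kac_sphere N = restrict_space (borel_Rn N) (kac_sphere N)"

definition radial_projection :: "nat \<Rightarrow> (nat \<Rightarrow> real) \<Rightarrow> (nat \<Rightarrow> real)" where
  "radial_projection N v = (\<lambda>i\<in>{..<N}. sqrt (real N) * v i / L2_set v {..<N})"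

text \<open>
  Normalised surface area on the sphere: a Borel set \<open>A\<close> of the sphere gets the proportion of the
  volume of the ball that is occupied by the cone from the origin over \<open>A\<close>. The origin, which
  \<open>radial_projection\<close> does not map to the sphere, is a null set if \<open>N > 0\<close>.
\<close>

definition sphere_uniform :: "nat \<Rightarrow> (nat \<Rightarrow> real) measure" where
  "sphere_uniform N =
     restrict_space
       (distr (uniform_measure (lborel_Rn N) (unit_ball_Rn N)) (borel_Rn N) (radial_projection N))
       (kac_sphere N)"

lemma sets_sphere_uniform: "sets (sphere_uniform N) = sets (borel_kac_sphere N)"
  unfolding sphere_uniform_def borel_kac_sphere_def
  by (intro sets_restrict_space_cong) simp

lemma measurable_L2_set_Rn[measurable]: "(\<lambda>v. L2_set v {..<N}) \<in> borel_measurable (borel_Rn N)"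
  unfolding L2_set_def borel_Rn_def by measurable

lemma sets_lborel_Rn: "sets (lborel_Rn N) = sets (borel_Rn N)"
  unfolding lborel_Rn_def borel_Rn_def by (intro sets_PiM_cong) auto

lemma measurable_radial_projection[measurable]: "radial_projection N \<in> borel_Rn N \<rightarrow>\<^sub>M borel_Rn N"
proof -
  have [measurable]: "(\<lambda>v. L2_set v {..<N}) \<in> borel_measurable (\<Pi>\<^sub>M i\<in>{..<N}. borel)"
    using measurable_L2_set_Rn unfolding borel_Rn_def .
  show ?thesis unfolding radial_projection_def borel_Rn_def by measurable
qed

lemma kac_sphere_in_sets[measurable]: "kac_sphere N \<in> sets (borel_Rn N)"
  unfolding kac_sphere_def by measurable

lemma unit_ball_Rn_in_sets[measurable]: "unit_ball_Rn N \<in> sets (borel_Rn N)"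
  unfolding unit_ball_Rn_def by measurable

lemma emeasure_unit_ball_Rn: "emeasure (lborel_Rn N) (unit_ball_Rn N) = ennreal (unit_ball_vol (real N))"
proof -
  have "unit_ball_Rn N = {f. sqrt (\<Sum>i\<in>{..<N}. (f i)\<^sup>2) \<le> 1} \<inter> space (Pi\<^sub>M {..<N} (\<lambda>_. lborel))"
    unfolding unit_ball_Rn_def L2_set_def borel_Rn_def by (auto simp: space_PiM)
  then show ?thesis using emeasure_cball_aux[of "{..<N}" 1] by (simp add: lborel_Rn_def)
qed

lemma prob_space_sphere_uniform: "N \<ge> 1 \<Longrightarrow> prob_space (sphere_uniform N)"
proof -
  assume N: "N \<ge> 1"
  let ?U = "uniform_measure (lborel_Rn N) (unit_ball_Rn N)"
  let ?D = "distr ?U (borel_Rn N) (radial_projection N)"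
  have U: "prob_space ?U" by (rule prob_space_uniform_measure) (use unit_ball_vol_pos[of "real N"] in \<open>auto simp: emeasure_unit_ball_Rn simp del: unit_ball_vol_pos\<close>)
  have mU: "radial_projection N \<in> ?U \<rightarrow>\<^sub>M borel_Rn N"
    using measurable_radial_projection measurable_cong_sets[of ?U "borel_Rn N" "borel_Rn N" "borel_Rn N"] sets_lborel_Rn by auto
  interpret product_sigma_finite "\<lambda>_::nat. lborel::real measure" by standard
  have "emeasure (lborel_Rn N) (Pi\<^sub>E {..<N} (\<lambda>_. {0})) = 0"
    unfolding lborel_Rn_def using N by (subst emeasure_PiM) auto
  moreover have "Pi\<^sub>E {..<N} (\<lambda>_. {0}) \<in> sets (lborel_Rn N)"
    unfolding lborel_Rn_def by (intro sets_PiM_I_finite) auto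
  ultimately have "Pi\<^sub>E {..<N} (\<lambda>_. {0::real}) \<in> null_sets (lborel_Rn N)" by auto
  then have "AE v in lborel_Rn N. v \<notin> Pi\<^sub>E {..<N} (\<lambda>_. {0::real})" by (rule AE_not_in)
  moreover have "radial_projection N v \<in> kac_sphere N"
    if v: "v \<in> space (lborel_Rn N)" "v \<notin> Pi\<^sub>E {..<N} (\<lambda>_. {0::real})" for v
  proof -
    from v have nz: "L2_set v {..<N} \<noteq> 0"
      by (force simp: lborel_Rn_def space_PiM PiE_def Pi_def L2_set_eq_0_iff extensional_def)
    have "L2_set (radial_projection N v) {..<N} =
        L2_set (\<lambda>i. (sqrt (real N) / L2_set v {..<N}) * v i) {..<N}"
      by (rule L2_set_cong) (auto simp: radial_projection_def)
    also have "\<dots> = sqrt (real N) / L2_set v {..<N} * L2_set v {..<N}"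
      by (rule L2_set_right_distrib[symmetric]) simp
    finally show ?thesis using nz
      by (simp add: kac_sphere_def borel_Rn_def space_PiM radial_projection_def)
  qed
  ultimately have "AE v in lborel_Rn N. radial_projection N v \<in> kac_sphere N"
    by (simp add: AE_mp[OF _ AE_I2])
  then have "AE v in ?U. radial_projection N v \<in> kac_sphere N"
    by (intro AE_uniform_measureI) (auto simp: sets_lborel_Rn)
  moreover have "{v \<in> space ?U. radial_projection N v \<in> kac_sphere N} \<in> sets ?U"
    using measurable_sets[OF mU kac_sphere_in_sets[of N]] by (simp add: vimage_def Int_def conj_commute)
  ultimately have "emeasure ?U {v \<in> space ?U. radial_projection N v \<in> kac_sphere N} = 1"
    by (intro prob_space.emeasure_eq_1_AE[OF U]) (auto elim!: AE_mp intro!: AE_I2)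
  then have D: "emeasure ?D (kac_sphere N) = 1"
    using emeasure_distr[OF mU kac_sphere_in_sets[of N]] by (simp add: vimage_def Int_def conj_commute)
  have sub: "kac_sphere N \<subseteq> space (borel_Rn N)" by (auto simp: kac_sphere_def)
  show ?thesis
    unfolding sphere_uniform_def
    using D sub by (intro prob_spaceI) (simp add: emeasure_restrict_space space_restrict_space Int_absorb2)
qed


section \<open>Relative entropy\<close>

text \<open>
  As $h \log h \ge -1/e$, the integral below always exists in $(-\infty, \infty]$ when \<open>\<nu>\<close> is
  finite: the subtracted negative part is finite. The convention $0 \log 0 = 0$ is \<open>ln 0 = 0\<close>.
\<close>

definition relative_entropy :: "'a measure \<Rightarrow> 'a measure \<Rightarrow> ereal" where
  "relative_entropy \<mu> \<nu> =
     (if absolutely_continuous \<nu> \<mu> then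
        let h = (\<lambda>x. enn2real (RN_deriv \<nu> \<mu> x)) in
          enn2ereal (\<integral>\<^sup>+ x. ennreal (h x * ln (h x)) \<partial>\<nu>) -
          enn2ereal (\<integral>\<^sup>+ x. ennreal (- (h x * ln (h x))) \<partial>\<nu>)
      else \<infinity>)"

definition std_gaussian :: "real measure" where
  "std_gaussian = density lborel (\<lambda>v. ennreal (exp (- v\<^sup>2 / 2) / sqrt (2 * pi)))"


section \<open>Chaotic sequences\<close>

definition symmetric_measure :: "nat \<Rightarrow> (nat \<Rightarrow> real) measure \<Rightarrow> bool" where
  "symmetric_measure N M \<longleftrightarrow> (\<forall>p. p permutes {..<N} \<longrightarrow> distr M M (\<lambda>v. v \<circ> p) = M)"

text \<open>This is the marginal on the first \<open>k\<close> coordinates only for a measure on $R^N$ with \<open>k \<le> N\<close>.\<close>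

definition marginal :: "nat \<Rightarrow> (nat \<Rightarrow> real) measure \<Rightarrow> (nat \<Rightarrow> real) measure" where
  "marginal k M = distr M (borel_Rn k) (\<lambda>v. restrict v {..<k})"

definition weakly_converges_Rn ::
  "nat \<Rightarrow> (nat \<Rightarrow> (nat \<Rightarrow> real) measure) \<Rightarrow> (nat \<Rightarrow> real) measure \<Rightarrow> bool" where
  "weakly_converges_Rn k Ms M \<longleftrightarrow>
     (\<forall>f. continuous_map (powertop_real {..<k}) euclideanreal f \<and>
          bounded (f ` topspace (powertop_real {..<k})) \<longrightarrow>
          (\<lambda>N. \<integral>v. f v \<partial>Ms N) \<longlonglongrightarrow> (\<integral>v. f v \<partial>M))"

definition chaotic :: "real measure \<Rightarrow> (nat \<Rightarrow> (nat \<Rightarrow> real) measure) \<Rightarrow> bool" where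
  "chaotic \<mu> \<mu>s \<longleftrightarrow>
     (\<forall>N\<ge>1. symmetric_measure N (\<mu>s N)) \<and>
     (\<forall>k\<ge>1. weakly_converges_Rn k (\<lambda>N. marginal k (\<mu>s N)) (\<Pi>\<^sub>M i\<in>{..<k}. \<mu>))"

end

theory Submission
  imports Defs "HOL-Real_Asymp.Real_Asymp"
begin

text \<open>
  Relative entropy is a Legendre transform (Donsker and Varadhan): $H(\mu | \nu)$ is the supremum of
  $\int \Phi\,d\mu - \ln \int e^\Phi\,d\nu$ over test functions \<open>\<Phi>\<close>. On the sphere, use the additive test
  functions $\Phi(v) = \sum_i \varphi(v_i)$. By symmetry the linear term is $N$ times the mean of
  $\varphi(v_0)$, and this mean tends to $\int \varphi\,d\mu$ because the first marginals converge weakly. So after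
  division by $N$ the inequality $\int \varphi\,d\mu - \ln \int e^\varphi\,d\gamma \le \liminf_N H(\mu^{(N)} | \sigma^N) / N$
  follows once the Laplace transform on the sphere is known not to exceed that of independent Gaussian
  coordinates on the exponential scale:
  $$\int e^{\sum_i \varphi(v_i)}\,d\sigma^N \le \mathrm{poly}(N) \Big(\int e^\varphi\,d\gamma\Big)^N .$$
  The supremum over $\varphi$ then gives $H(\mu | \gamma)$ on the left.

  The Laplace bound (\<open>sphere_laplace_le_gaussian\<close>) is geometric. Uniform measure on the sphere is the radial
  projection of uniform measure on the ball of radius $\sqrt N$. A fixed share of that ball lies in a shell of
  relative width $1/N$, where the projection moves the coordinates by at most $1$ in total and hence changes
  $\sum_i \varphi(v_i)$ by at most the Lipschitz constant of $\varphi$. In the ball the Gaussian density is at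
  least $(2 \pi e)^{-N/2}$, and the volume of the ball is $(2 \pi e)^{N/2}$ up to a polynomial factor. So
  uniform measure on the ball is dominated by a polynomial multiple of the Gaussian product measure.

  Weak convergence requires $\varphi$ to be bounded and continuous, and the projection argument requires it to
  be Lipschitz. It therefore has to be shown that bounded Lipschitz functions exhaust the supremum
  (\<open>relative_entropy_le_bounded_lipschitz\<close>). They are dense in $L^1(\mu) \cap L^1(\gamma)$, so they give as much as
  bounded measurable functions, and among these the truncations of $\ln (d\mu / d\gamma)$ attain the entropy in
  the limit.
\<close>

section \<open>The variational formula for relative entropy\<close>

text \<open>
  This bound makes the negative part of the entropy integral finite on a probability space, and it is
  the integrable lower bound that a passage to the limit by Fatou's lemma requires.
\<close>

lemma mult_ln_ge_minus_one:
  fixes x :: real assumes "0 \<le> x" shows "-1 \<le> x * ln x"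
proof (cases "x = 0")
  case False
  with assms have x: "0 < x" by simp
  have "ln (inverse x) \<le> inverse x - 1"
    using x by (intro ln_le_minus_one) auto
  then have "x * (- ln x) \<le> x * (inverse x - 1)"
    using x by (intro mult_left_mono) (auto simp: ln_inverse)
  then show ?thesis using x by (simp add: algebra_simps)
qed simp

text \<open>
  The Fenchel--Young inequality: $e^t$ is the convex conjugate of $x \ln x - x$. It is
  $1 + u \le e^u$ at $u = t - \ln x$, multiplied by $x$.
\<close>

lemma mult_le_mult_ln_add_exp:
  fixes x t :: real assumes "0 \<le> x" shows "x * t \<le> x * ln x - x + exp t"
proof (cases "x = 0")
  case False
  with assms have x: "0 < x" by simp
  have "x * (1 + (t - ln x)) \<le> x * exp (t - ln x)"
    using x by (intro mult_left_mono exp_ge_add_one_self) auto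
  also have "\<dots> = exp t" using x by (simp add: exp_diff)
  finally show ?thesis by (simp add: algebra_simps)
qed simp

text \<open>
  Since the negative part of $h \ln h$ has a finite integral, the difference of extended integrals that
  defines the entropy is either an ordinary integral or infinite.
\<close>

lemma relative_entropy_eq_integral:
  fixes \<mu> \<nu> :: "'a measure"
  assumes "prob_space \<mu>" "prob_space \<nu>" and sets: "sets \<mu> = sets \<nu>"
    and ac: "absolutely_continuous \<nu> \<mu>"
  obtains h where "h \<in> borel_measurable \<nu>" "\<And>x. 0 \<le> h x" "\<mu> = density \<nu> (\<lambda>x. ennreal (h x))"
    "relative_entropy \<mu> \<nu> =
      (if integrable \<nu> (\<lambda>x. h x * ln (h x)) then ereal (\<integral>x. h x * ln (h x) \<partial>\<nu>) else \<infinity>)"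
proof -
  interpret M: prob_space \<mu> by fact
  interpret N: prob_space \<nu> by fact
  define h where "h = (\<lambda>x. enn2real (RN_deriv \<nu> \<mu> x))"
  have h_m[measurable]: "h \<in> borel_measurable \<nu>" unfolding h_def by measurable
  have h0: "0 \<le> h x" for x by (simp add: h_def)
  have "AE x in \<nu>. RN_deriv \<nu> \<mu> x \<noteq> \<infinity>"
    using N.RN_deriv_finite[OF M.sigma_finite_measure_axioms ac sets] .
  then have "AE x in \<nu>. RN_deriv \<nu> \<mu> x = ennreal (h x)"
    by eventually_elim (simp add: h_def less_top)
  then have "density \<nu> (RN_deriv \<nu> \<mu>) = density \<nu> (\<lambda>x. ennreal (h x))"
    by (intro density_cong) auto
  then have dens: "\<mu> = density \<nu> (\<lambda>x. ennreal (h x))"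
    using N.density_RN_deriv[OF ac sets] by simp
  let ?f = "\<lambda>x. h x * ln (h x)"
  have "(\<integral>\<^sup>+x. ennreal (- ?f x) \<partial>\<nu>) \<le> (\<integral>\<^sup>+x. 1 \<partial>\<nu>)"
  proof (rule nn_integral_mono)
    fix x show "ennreal (- ?f x) \<le> 1"
      using mult_ln_ge_minus_one[OF h0[of x]] by simp
  qed
  also have "\<dots> = 1" by (simp add: N.emeasure_space_1)
  finally have neg: "(\<integral>\<^sup>+x. ennreal (- ?f x) \<partial>\<nu>) \<noteq> \<infinity>" by (auto simp: top_unique)
  have re: "relative_entropy \<mu> \<nu> =
      enn2ereal (\<integral>\<^sup>+x. ennreal (?f x) \<partial>\<nu>) - enn2ereal (\<integral>\<^sup>+x. ennreal (- ?f x) \<partial>\<nu>)"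
    unfolding relative_entropy_def Let_def using ac by (simp add: h_def)
  have "relative_entropy \<mu> \<nu> = (if integrable \<nu> ?f then ereal (\<integral>x. ?f x \<partial>\<nu>) else \<infinity>)"
  proof (cases "integrable \<nu> ?f")
    case True
    then have pos: "(\<integral>\<^sup>+x. ennreal (?f x) \<partial>\<nu>) \<noteq> \<infinity>" by (simp add: real_integrable_def)
    show ?thesis
      using True pos neg unfolding re real_lebesgue_integral_def[OF True]
      by (cases "\<integral>\<^sup>+x. ennreal (?f x) \<partial>\<nu>"; cases "\<integral>\<^sup>+x. ennreal (- ?f x) \<partial>\<nu>")
        (auto simp: enn2ereal_ennreal)
  next
    case False
    have "?f \<in> borel_measurable \<nu>" by measurable
    then have "(\<integral>\<^sup>+x. ennreal (?f x) \<partial>\<nu>) = \<infinity>"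
      using False neg unfolding real_integrable_def by blast
    then show ?thesis
      using False neg unfolding re
      by (cases "\<integral>\<^sup>+x. ennreal (- ?f x) \<partial>\<nu>") (auto simp: enn2ereal_ennreal)
  qed
  then show ?thesis using that h_m h0 dens by blast
qed

text \<open>
  Subtracting the constant $\ln \int e^\Phi d\nu$ from \<open>\<Phi>\<close> makes $e^\Phi$ a probability density.
  The Fenchel--Young inequality at the density $h$ of \<open>\<mu>\<close> can then be integrated, and its two
  correction terms $-h$ and $e^\Phi$ have integrals $-1$ and $1$.
\<close>

theorem relative_entropy_ge_Donsker_Varadhan:
  fixes \<mu> \<nu> :: "'a measure" and \<Phi> :: "'a \<Rightarrow> real"
  assumes "prob_space \<mu>" "prob_space \<nu>" and sets: "sets \<mu> = sets \<nu>"
    and \<Phi>_m[measurable]: "\<Phi> \<in> borel_measurable \<nu>"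
    and bound: "\<And>x. x \<in> space \<nu> \<Longrightarrow> \<bar>\<Phi> x\<bar> \<le> K"
  shows "ereal ((\<integral>x. \<Phi> x \<partial>\<mu>) - ln (\<integral>x. exp (\<Phi> x) \<partial>\<nu>)) \<le> relative_entropy \<mu> \<nu>"
proof (cases "absolutely_continuous \<nu> \<mu>")
  case ac: True
  interpret M: prob_space \<mu> by fact
  interpret N: prob_space \<nu> by fact
  obtain h where [measurable]: "h \<in> borel_measurable \<nu>" and h0: "\<And>x. 0 \<le> h x"
    and dens: "\<mu> = density \<nu> (\<lambda>x. ennreal (h x))"
    and re: "relative_entropy \<mu> \<nu> =
      (if integrable \<nu> (\<lambda>x. h x * ln (h x)) then ereal (\<integral>x. h x * ln (h x) \<partial>\<nu>) else \<infinity>)"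
    using relative_entropy_eq_integral[OF assms(1-3) ac] by blast
  show ?thesis
  proof (cases "integrable \<nu> (\<lambda>x. h x * ln (h x))")
    case True
    have int_exp: "integrable \<nu> (\<lambda>x. exp (\<Phi> x))"
    proof (rule N.integrable_const_bound[where B = "exp K"])
      show "AE x in \<nu>. norm (exp (\<Phi> x)) \<le> exp K"
        using bound by (intro AE_I2) (auto dest!: bound)
    qed simp
    define Z where "Z = (\<integral>x. exp (\<Phi> x) \<partial>\<nu>)"
    have "(\<integral>x. exp (- K) \<partial>\<nu>) \<le> Z"
      unfolding Z_def using int_exp by (intro integral_mono) (auto dest!: bound)
    then have Z: "0 < Z"
      using N.prob_space by (simp add: less_le_trans[OF exp_gt_zero])
    have sp: "space \<mu> = space \<nu>" using sets by (rule sets_eq_imp_space_eq)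
    have "integrable \<mu> \<Phi>"
    proof (rule M.integrable_const_bound[where B = K])
      show "AE x in \<mu>. norm (\<Phi> x) \<le> K" using bound by (intro AE_I2) (auto simp: sp)
      show "\<Phi> \<in> borel_measurable \<mu>" using \<Phi>_m measurable_cong_sets[OF sets refl] by blast
    qed
    then have int_h\<Phi>: "integrable \<nu> (\<lambda>x. h x * \<Phi> x)"
      using h0 unfolding dens by (subst (asm) integrable_real_density) auto
    have "integrable \<mu> (\<lambda>x. 1::real)" by simp
    then have int_h: "integrable \<nu> h"
      using h0 unfolding dens by (subst (asm) integrable_real_density) auto
    have "(\<integral>x. 1 \<partial>\<mu>) = (1::real)" using M.prob_space by simp
    then have h1: "(\<integral>x. h x \<partial>\<nu>) = 1"
      using h0 unfolding dens by (subst (asm) integral_real_density) auto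
    have "(\<integral>x. \<Phi> x \<partial>\<mu>) = (\<integral>x. h x * \<Phi> x \<partial>\<nu>)"
      using h0 unfolding dens by (subst integral_real_density) auto
    then have "(\<integral>x. \<Phi> x \<partial>\<mu>) - ln Z = (\<integral>x. h x * \<Phi> x - h x * ln Z \<partial>\<nu>)"
      using int_h int_h\<Phi> h1 by simp
    also have "\<dots> \<le> (\<integral>x. h x * ln (h x) - h x + exp (\<Phi> x) / Z \<partial>\<nu>)"
    proof (rule integral_mono)
      fix x
      show "h x * \<Phi> x - h x * ln Z \<le> h x * ln (h x) - h x + exp (\<Phi> x) / Z"
        using mult_le_mult_ln_add_exp[OF h0[of x], of "\<Phi> x - ln Z"] Z
        by (simp add: exp_diff algebra_simps)
    qed (use int_h int_h\<Phi> int_exp True in auto)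
    also have "\<dots> = (\<integral>x. h x * ln (h x) \<partial>\<nu>)"
      using int_h int_exp True h1 Z by (simp add: Z_def)
    finally show ?thesis using True by (simp add: re Z_def)
  qed (simp add: re)
qed (simp add: relative_entropy_def)

text \<open>
  Conversely, multiples $t 1_A$ of the indicator of a \<open>\<nu>\<close>-null set \<open>A\<close> force $\mu(A) = 0$ as
  $t \to \infty$, so that \<open>\<mu>\<close> has a density $h$. The optimal test function is $\ln h$; as it may be
  unbounded, it is truncated to $[-n, n]$. The exponential of the truncation is at most $h + e^{-n}$, so
  the logarithmic term costs no more than $e^{-n}$, and Fatou's lemma lets $n$ tend to infinity.
\<close>

theorem relative_entropy_le_Donsker_Varadhan:
  fixes \<mu> \<nu> :: "'a measure"
  assumes "prob_space \<mu>" "prob_space \<nu>" and sets: "sets \<mu> = sets \<nu>"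
    and dual: "\<And>\<Phi> K. \<Phi> \<in> borel_measurable \<nu> \<Longrightarrow> (\<And>x. \<bar>\<Phi> x\<bar> \<le> K) \<Longrightarrow>
      (\<integral>x. \<Phi> x \<partial>\<mu>) - ln (\<integral>x. exp (\<Phi> x) \<partial>\<nu>) \<le> c"
  shows "relative_entropy \<mu> \<nu> \<le> ereal c"
proof -
  interpret M: prob_space \<mu> by fact
  interpret N: prob_space \<nu> by fact
  have ac: "absolutely_continuous \<nu> \<mu>"
    unfolding absolutely_continuous_def
  proof
    fix A assume A: "A \<in> null_sets \<nu>"
    then have [measurable]: "A \<in> sets \<nu>" "A \<in> sets \<mu>" using sets by auto
    have le: "t * measure \<mu> A \<le> c" if "0 \<le> t" for t
    proof -
      have "AE x in \<nu>. x \<notin> A" using A by (rule AE_not_in)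
      then have "(\<integral>x. exp (t * indicator A x) \<partial>\<nu>) = (\<integral>x. 1 \<partial>\<nu>)"
        by (intro integral_cong_AE) (auto simp: indicator_def)
      then have "(\<integral>x. exp (t * indicator A x) \<partial>\<nu>) = 1" using N.prob_space by simp
      moreover have "\<bar>t * indicator A x\<bar> \<le> t" for x
        using that by (simp add: indicator_def)
      moreover have "(\<integral>x. t * indicator A x \<partial>\<mu>) = t * measure \<mu> A" by simp
      ultimately show ?thesis using dual[of "\<lambda>x. t * indicator A x" t] by simp
    qed
    have "measure \<mu> A = 0"
    proof (rule ccontr)
      assume "measure \<mu> A \<noteq> 0"
      then have "0 < measure \<mu> A" by (simp add: zero_less_measure_iff)
      then have "0 \<le> (\<bar>c\<bar> + 1) / measure \<mu> A" "(\<bar>c\<bar> + 1) / measure \<mu> A * measure \<mu> A = \<bar>c\<bar> + 1" by auto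
      then show False using le[of "(\<bar>c\<bar> + 1) / measure \<mu> A"] by linarith
    qed
    then show "A \<in> null_sets \<mu>" by (auto simp: M.emeasure_eq_measure)
  qed
  obtain h where [measurable]: "h \<in> borel_measurable \<nu>" and h0: "\<And>x. 0 \<le> h x"
    and dens: "\<mu> = density \<nu> (\<lambda>x. ennreal (h x))"
    and re: "relative_entropy \<mu> \<nu> =
      (if integrable \<nu> (\<lambda>x. h x * ln (h x)) then ereal (\<integral>x. h x * ln (h x) \<partial>\<nu>) else \<infinity>)"
    using relative_entropy_eq_integral[OF assms(1-3) ac] by blast
  have "integrable \<mu> (\<lambda>x. 1::real)" by simp
  then have int_h: "integrable \<nu> h"
    using h0 unfolding dens by (subst (asm) integrable_real_density) auto
  have "(\<integral>x. 1 \<partial>\<mu>) = (1::real)" using M.prob_space by simp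
  then have h1: "(\<integral>x. h x \<partial>\<nu>) = 1"
    using h0 unfolding dens by (subst (asm) integral_real_density) auto
  \<comment> \<open>The truncation of \<open>ln 0\<close> has to be \<open>- n\<close>, so that its exponential is small;
    but \<open>ln 0 = 0\<close> by convention.\<close>
  define \<Phi> where "\<Phi> n x = (if h x = 0 then - real n else max (- real n) (min (real n) (ln (h x))))" for n x
  have \<Phi>_m[measurable]: "\<Phi> n \<in> borel_measurable \<nu>" for n unfolding \<Phi>_def by measurable
  have \<Phi>_bound: "\<bar>\<Phi> n x\<bar> \<le> real n" for n x by (auto simp: \<Phi>_def)
  have exp\<Phi>: "exp (\<Phi> n x) \<le> h x + exp (- real n)" for n x
  proof (cases "h x = 0")
    case False
    then have "0 < h x" using h0[of x] by simp
    have "exp (\<Phi> n x) \<le> exp (max (- real n) (ln (h x)))" using False by (auto simp: \<Phi>_def)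
    also have "\<dots> \<le> h x + exp (- real n)" using \<open>0 < h x\<close> by (auto simp: max_def)
    finally show ?thesis .
  qed (simp add: \<Phi>_def)
  have \<Phi>_ge: "- 1 \<le> h x * \<Phi> n x" for n x
  proof (cases "h x \<le> 1")
    case True
    have "h x * ln (h x) \<le> h x * \<Phi> n x"
    proof (cases "h x = 0")
      case False
      then have "ln (h x) \<le> 0" using True h0[of x] by simp
      then have "ln (h x) \<le> \<Phi> n x" using False by (auto simp: \<Phi>_def)
      then show ?thesis using h0 by (rule mult_left_mono)
    qed simp
    then show ?thesis using mult_ln_ge_minus_one[OF h0[of x]] by linarith
  next
    case False
    then have "0 \<le> max (- real n) (min (real n) (ln (h x)))"
      by (intro max.coboundedI2 min.boundedI ln_ge_zero) auto
    moreover have "h x \<noteq> 0" using False by auto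
    ultimately have "0 \<le> \<Phi> n x" unfolding \<Phi>_def by (simp only: if_False)
    then have "0 \<le> h x * \<Phi> n x" using h0[of x] by simp
    then show ?thesis by linarith
  qed
  have int_\<Phi>: "(\<integral>\<^sup>+x. ennreal (h x * \<Phi> n x + 1) \<partial>\<nu>) \<le> ennreal (c + exp (- real n) + 1)" for n
  proof -
    have iM: "integrable \<mu> (\<Phi> n)"
      using \<Phi>_bound \<Phi>_m[folded measurable_cong_sets[OF sets refl]]
      by (intro M.integrable_const_bound[where B = n]) auto
    have i: "integrable \<nu> (\<lambda>x. h x * \<Phi> n x)"
      using h0 iM unfolding dens by (subst (asm) integrable_real_density) auto
    have eq: "(\<integral>x. \<Phi> n x \<partial>\<mu>) = (\<integral>x. h x * \<Phi> n x \<partial>\<nu>)"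
      using h0 unfolding dens by (subst integral_real_density) auto
    have ie: "integrable \<nu> (\<lambda>x. exp (\<Phi> n x))"
      by (rule N.integrable_const_bound[where B = "exp (real n)"])
        (use abs_le_D1[OF \<Phi>_bound] in auto)
    have "(\<integral>x. exp (\<Phi> n x) \<partial>\<nu>) \<le> (\<integral>x. h x + exp (- real n) \<partial>\<nu>)"
      using exp\<Phi> int_h ie by (intro integral_mono) auto
    also have "\<dots> = 1 + exp (- real n)" using int_h h1 N.prob_space by simp
    finally have le: "(\<integral>x. exp (\<Phi> n x) \<partial>\<nu>) \<le> 1 + exp (- real n)" .
    have "exp (- real n) = (\<integral>x. exp (- real n) \<partial>\<nu>)" using N.prob_space by simp
    also have "\<dots> \<le> (\<integral>x. exp (\<Phi> n x) \<partial>\<nu>)"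
      using abs_le_D2[OF \<Phi>_bound, of n] ie by (intro integral_mono) (auto simp: minus_le_iff)
    finally have pos: "0 < (\<integral>x. exp (\<Phi> n x) \<partial>\<nu>)" by (rule less_le_trans[OF exp_gt_zero])
    have "ln (\<integral>x. exp (\<Phi> n x) \<partial>\<nu>) \<le> exp (- real n)"
      using ln_le_minus_one[OF pos] le by linarith
    then have "(\<integral>x. h x * \<Phi> n x \<partial>\<nu>) \<le> c + exp (- real n)"
      using dual[OF \<Phi>_m \<Phi>_bound, of n] unfolding eq by linarith
    then have "(\<integral>x. h x * \<Phi> n x + 1 \<partial>\<nu>) \<le> c + exp (- real n) + 1"
      using i N.prob_space by simp
    moreover have "(\<integral>\<^sup>+x. ennreal (h x * \<Phi> n x + 1) \<partial>\<nu>) = ennreal (\<integral>x. h x * \<Phi> n x + 1 \<partial>\<nu>)"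
    proof (rule nn_integral_eq_integral)
      show "AE x in \<nu>. 0 \<le> h x * \<Phi> n x + 1"
      proof (rule AE_I2)
        fix x show "0 \<le> h x * \<Phi> n x + 1" using \<Phi>_ge[of x n] by linarith
      qed
    qed (use i in auto)
    ultimately show ?thesis by (simp add: ennreal_leI)
  qed
  have lim: "(\<lambda>n. h x * \<Phi> n x) \<longlonglongrightarrow> h x * ln (h x)" for x
  proof (rule tendsto_eventually)
    obtain n0 :: nat where n0: "\<bar>ln (h x)\<bar> \<le> real n0" using real_arch_simple by blast
    show "\<forall>\<^sub>F n in sequentially. h x * \<Phi> n x = h x * ln (h x)"
      using eventually_ge_at_top[of n0] by eventually_elim (use n0 in \<open>auto simp: \<Phi>_def\<close>)
  qed
  have "(\<integral>\<^sup>+x. ennreal (h x * ln (h x) + 1) \<partial>\<nu>)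
      = (\<integral>\<^sup>+x. liminf (\<lambda>n. ennreal (h x * \<Phi> n x + 1)) \<partial>\<nu>)"
  proof (rule nn_integral_cong)
    fix x
    have "(\<lambda>n. ennreal (h x * \<Phi> n x + 1)) \<longlonglongrightarrow> ennreal (h x * ln (h x) + 1)"
      using tendsto_add[OF lim tendsto_const, of x 1] by (rule tendsto_ennrealI)
    then show "ennreal (h x * ln (h x) + 1) = liminf (\<lambda>n. ennreal (h x * \<Phi> n x + 1))"
      using lim_imp_Liminf sequentially_bot by metis
  qed
  also have "\<dots> \<le> liminf (\<lambda>n. \<integral>\<^sup>+x. ennreal (h x * \<Phi> n x + 1) \<partial>\<nu>)"
    by (intro nn_integral_liminf) measurable
  also have "\<dots> \<le> liminf (\<lambda>n. ennreal (c + exp (- real n) + 1))"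
    by (intro Liminf_mono always_eventually allI int_\<Phi>)
  also have "\<dots> = ennreal (c + 0 + 1)"
  proof (rule lim_imp_Liminf)
    have "(\<lambda>n. exp (- real n)) \<longlonglongrightarrow> 0"
      by (rule filterlim_compose[OF exp_at_bot])
        (simp add: filterlim_uminus_at_top_at_bot filterlim_real_sequentially
           filterlim_compose[OF filterlim_uminus_at_bot_at_top])
    then show "(\<lambda>n. ennreal (c + exp (- real n) + 1)) \<longlonglongrightarrow> ennreal (c + 0 + 1)"
      by (intro tendsto_intros tendsto_ennrealI)
  qed simp
  finally have le: "(\<integral>\<^sup>+x. ennreal (h x * ln (h x) + 1) \<partial>\<nu>) \<le> ennreal (c + 1)" by simp
  have nn: "0 \<le> h x * ln (h x) + 1" for x using mult_ln_ge_minus_one[OF h0[of x]] by linarith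
  have int1: "integrable \<nu> (\<lambda>x. h x * ln (h x) + 1)"
    using nn le by (intro integrableI_nonneg) (auto simp: less_top[symmetric] top_unique)
  then have "integrable \<nu> (\<lambda>x. h x * ln (h x) + 1 - 1)" by (intro Bochner_Integration.integrable_diff) auto
  then have int: "integrable \<nu> (\<lambda>x. h x * ln (h x))" by simp
  have "0 \<le> c"
    using dual[of "\<lambda>_. 0" 0] N.prob_space by simp
  then have "(\<integral>x. h x * ln (h x) + 1 \<partial>\<nu>) \<le> c + 1"
    using le nn int1 by (subst (asm) nn_integral_eq_integral) (auto simp del: ennreal_plus)
  then show ?thesis using int N.prob_space by (simp add: re)
qed

section \<open>Bounded Lipschitz test functions\<close>

definition bounded_lipschitz :: "('a::metric_space \<Rightarrow> real) \<Rightarrow> bool" where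
  "bounded_lipschitz g \<longleftrightarrow> (\<exists>L. L-lipschitz_on UNIV g) \<and> (\<exists>K. \<forall>x. \<bar>g x\<bar> \<le> K)"

lemma bounded_lipschitz_borel_measurable:
  assumes "bounded_lipschitz g" shows "g \<in> borel_measurable borel"
  using assms lipschitz_on_continuous_on borel_measurable_continuous_onI
  unfolding bounded_lipschitz_def by blast

lemma bounded_lipschitz_const: "bounded_lipschitz (\<lambda>_. c)"
  unfolding bounded_lipschitz_def using lipschitz_on_constant by blast

lemma bounded_lipschitz_add:
  assumes "bounded_lipschitz f" "bounded_lipschitz g"
  shows "bounded_lipschitz (\<lambda>x. f x + g x)"
proof -
  from assms obtain L1 K1 L2 K2 where
    *: "L1-lipschitz_on UNIV f" "\<And>x. \<bar>f x\<bar> \<le> K1" "L2-lipschitz_on UNIV g" "\<And>x. \<bar>g x\<bar> \<le> K2"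
    unfolding bounded_lipschitz_def by blast
  have "\<bar>f x + g x\<bar> \<le> K1 + K2" for x using *(2)[of x] *(4)[of x] by linarith
  then show ?thesis unfolding bounded_lipschitz_def using lipschitz_on_add[OF *(1,3)] by blast
qed

lemma bounded_lipschitz_cmult:
  assumes "bounded_lipschitz f"
  shows "bounded_lipschitz (\<lambda>x. c * f x)"
proof -
  from assms obtain L K where *: "L-lipschitz_on UNIV f" "\<And>x. \<bar>f x\<bar> \<le> K"
    unfolding bounded_lipschitz_def by blast
  have "\<bar>c * f x\<bar> \<le> \<bar>c\<bar> * K" for x using *(2)[of x] by (simp add: abs_mult mult_left_mono)
  then show ?thesis unfolding bounded_lipschitz_def using lipschitz_on_cmult_real[OF *(1)] by blast
qed

lemma bounded_lipschitz_clamp: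
  assumes "bounded_lipschitz f"
  shows "bounded_lipschitz (\<lambda>x. max (- K) (min K (f x)))"
proof -
  from assms obtain L where L: "L-lipschitz_on UNIV f"
    unfolding bounded_lipschitz_def by blast
  have "L-lipschitz_on UNIV (\<lambda>x. max (- K) (min K (f x)))"
  proof (rule lipschitz_onI)
    fix x y
    have "\<bar>max (- K) (min K (f x)) - max (- K) (min K (f y))\<bar> \<le> \<bar>f x - f y\<bar>"
      by (auto simp: max_def min_def)
    also have "\<dots> \<le> L * dist x y" using lipschitz_onD[OF L, of x y] by (simp add: dist_real_def)
    finally show "dist (max (- K) (min K (f x))) (max (- K) (min K (f y))) \<le> L * dist x y"
      by (simp add: dist_real_def)
  qed (rule lipschitz_on_nonneg[OF L])
  moreover have "\<bar>max (- K) (min K (f x))\<bar> \<le> \<bar>K\<bar>" for x by (auto simp: max_def min_def)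
  ultimately show ?thesis unfolding bounded_lipschitz_def by blast
qed

lemma bounded_lipschitz_tent:
  "bounded_lipschitz (\<lambda>x. max 0 (1 - real n * infdist x S))"
proof -
  have "(real n)-lipschitz_on UNIV (\<lambda>x. max 0 (1 - real n * infdist x S))"
  proof (rule lipschitz_onI)
    fix x y
    have "\<bar>real n * infdist x S - real n * infdist y S\<bar> = real n * \<bar>infdist x S - infdist y S\<bar>"
      by (simp add: abs_mult right_diff_distrib[symmetric])
    also have "\<dots> \<le> real n * dist x y"
      by (intro mult_left_mono infdist_triangle_abs) auto
    finally show "dist (max 0 (1 - real n * infdist x S)) (max 0 (1 - real n * infdist y S)) \<le> real n * dist x y"
      by (auto simp: dist_real_def max_def)
  qed simp
  moreover have "\<bar>max 0 (1 - real n * infdist x S)\<bar> \<le> 1" for x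
    using infdist_nonneg[of x S] by auto
  ultimately show ?thesis unfolding bounded_lipschitz_def by blast
qed

text \<open>
  The tents over \<open>S\<close> decrease pointwise to the indicator of \<open>S\<close> as they become steeper. The empty
  set is a separate case because the distance to it is \<open>0\<close> by convention.
\<close>

lemma bounded_lipschitz_approx_closed:
  fixes M :: "'a::metric_space measure"
  assumes "finite_measure M" and sets: "sets M = sets borel" and S: "closed S" and "0 < e"
  shows "\<exists>g. bounded_lipschitz g \<and> (\<integral>x. \<bar>indicator S x - g x\<bar> \<partial>M) < e"
proof (cases "S = {}")
  case True
  then show ?thesis using \<open>0 < e\<close> bounded_lipschitz_const[of 0] by (intro exI[of _ "\<lambda>_. 0"]) auto
next
  case False
  interpret finite_measure M by fact
  define g where "g n x = max 0 (1 - real n * infdist x S)" for n x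
  have bl: "bounded_lipschitz (g n)" for n unfolding g_def by (rule bounded_lipschitz_tent)
  note mc = measurable_cong_sets[OF sets refl]
  have [measurable]: "g n \<in> borel_measurable M" for n
    using bounded_lipschitz_borel_measurable[OF bl] mc by blast
  have [measurable]: "S \<in> sets M" using S sets by simp
  have "(\<lambda>n. \<integral>x. \<bar>indicator S x - g n x\<bar> \<partial>M) \<longlonglongrightarrow> (\<integral>x. 0 \<partial>M)"
  proof (rule integral_dominated_convergence[where w = "\<lambda>_. 1"])
    show "AE x in M. (\<lambda>n. \<bar>indicator S x - g n x\<bar>) \<longlonglongrightarrow> 0"
    proof (rule AE_I2)
      fix x
      show "(\<lambda>n. \<bar>indicator S x - g n x\<bar>) \<longlonglongrightarrow> 0"
      proof (cases "x \<in> S")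
        case True
        then show ?thesis by (simp add: g_def)
      next
        case xS: False
        then have d: "0 < infdist x S"
          using S False infdist_nonneg[of x S] in_closed_iff_infdist_zero[of S x] by fastforce
        obtain n0 :: nat where n0: "1 / infdist x S \<le> real n0" using real_arch_simple by blast
        show ?thesis
        proof (rule tendsto_eventually)
          show "\<forall>\<^sub>F n in sequentially. \<bar>indicator S x - g n x\<bar> = 0"
            using eventually_ge_at_top[of n0]
          proof eventually_elim
            case (elim n)
            then have "1 / infdist x S \<le> real n" using n0 by linarith
            then have "1 \<le> real n * infdist x S" using d by (simp add: field_simps)
            then show ?case using xS by (simp add: g_def)
          qed
        qed
      qed
    qed
    show "AE x in M. norm \<bar>indicator S x - g n x\<bar> \<le> 1" for n
      using infdist_nonneg[of _ S] by (intro AE_I2) (auto simp: g_def indicator_def max_def)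
  qed auto
  then have "(\<lambda>n. \<integral>x. \<bar>indicator S x - g n x\<bar> \<partial>M) \<longlonglongrightarrow> 0" by simp
  then have "\<forall>\<^sub>F n in sequentially. (\<integral>x. \<bar>indicator S x - g n x\<bar> \<partial>M) < e"
    using \<open>0 < e\<close> by (rule order_tendstoD)
  then show ?thesis using bl by (auto simp: eventually_sequentially)
qed

lemma bounded_lipschitz_integrable:
  assumes "finite_measure M" "sets M = sets borel" "bounded_lipschitz g"
  shows "integrable M g"
proof -
  interpret finite_measure M by fact
  obtain K where K: "\<And>x. \<bar>g x\<bar> \<le> K" using assms(3) unfolding bounded_lipschitz_def by blast
  have "g \<in> borel_measurable M"
    using bounded_lipschitz_borel_measurable[OF assms(3)] measurable_cong_sets[OF assms(2) refl] by blast
  then show ?thesis using K by (intro integrable_const_bound[where B = K]) auto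
qed

text \<open>
  Inner regularity replaces a Borel set by a compact, hence closed, subset, which the tents
  approximate. Linear combinations and dominated limits then reach every integrable function.
\<close>

lemma bounded_lipschitz_dense_L1:
  fixes M :: "'a::polish_space measure"
  assumes M: "finite_measure M" and sets: "sets M = sets borel" and f: "integrable M f" and "0 < e"
  shows "\<exists>g. bounded_lipschitz g \<and> (\<integral>x. \<bar>f x - g x\<bar> \<partial>M) < e"
  using f \<open>0 < e\<close>
proof (induction arbitrary: e rule: integrable_induct)
  case (base A c)
  interpret finite_measure M by fact
  define C where "C = \<bar>c\<bar> + 1"
  have C: "0 < C" "\<bar>c\<bar> < C" by (simp_all add: C_def)
  define d where "d = e / (2 * C)"
  have d: "0 < d" using \<open>0 < e\<close> C by (simp add: d_def)
  obtain K where K: "K \<subseteq> A" "compact K" "measure M A - d < measure M K"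
  proof (cases "measure M A - d < 0")
    case True
    then show ?thesis using that[of "{}"] by simp
  next
    case False
    have "emeasure M A = (SUP K \<in> {K. K \<subseteq> A \<and> compact K}. emeasure M K)"
      using base sets by (intro inner_regular) auto
    moreover have "ennreal (measure M A - d) < emeasure M A"
      using d False by (simp add: emeasure_eq_measure ennreal_less_iff)
    ultimately obtain K where "K \<subseteq> A" "compact K" "ennreal (measure M A - d) < emeasure M K"
      by (auto simp: less_SUP_iff)
    then show ?thesis using that[of K] False by (simp add: emeasure_eq_measure ennreal_less_iff)
  qed
  have [measurable]: "K \<in> sets M" "A \<in> sets M" using K sets base by (auto intro: borel_compact)
  obtain g where g: "bounded_lipschitz g" "(\<integral>x. \<bar>indicator K x - g x\<bar> \<partial>M) < d"
    using bounded_lipschitz_approx_closed[OF M sets compact_imp_closed[OF K(2)] d] by blast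
  note ig = bounded_lipschitz_integrable[OF M sets g(1)]
  have iK: "integrable M (indicator K :: _ \<Rightarrow> real)" by (simp add: integrable_indicator_iff less_top[symmetric])
  have iA: "integrable M (indicator A :: _ \<Rightarrow> real)" by (simp add: integrable_indicator_iff less_top[symmetric])
  have "(\<integral>x. \<bar>indicator A x *\<^sub>R c - c * g x\<bar> \<partial>M)
      \<le> (\<integral>x. \<bar>c\<bar> * (indicator A x - indicator K x + \<bar>indicator K x - g x\<bar>) \<partial>M)"
  proof (rule integral_mono)
    fix x
    have "\<bar>indicator A x *\<^sub>R c - c * g x\<bar> = \<bar>c\<bar> * \<bar>indicator A x - g x\<bar>"
      by (simp add: abs_mult[symmetric] algebra_simps)
    also have "\<dots> \<le> \<bar>c\<bar> * (indicator A x - indicator K x + \<bar>indicator K x - g x\<bar>)"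
      using K(1) by (intro mult_left_mono) (auto simp: indicator_def)
    finally show "\<bar>indicator A x *\<^sub>R c - c * g x\<bar>
      \<le> \<bar>c\<bar> * (indicator A x - indicator K x + \<bar>indicator K x - g x\<bar>)" .
  qed (use ig iA iK in auto)
  also have "\<dots> = \<bar>c\<bar> * (measure M A - measure M K + (\<integral>x. \<bar>indicator K x - g x\<bar> \<partial>M))"
    using ig iA iK by simp
  also have "\<dots> \<le> \<bar>c\<bar> * (d + d)" using K g by (intro mult_left_mono) auto
  also have "\<dots> < C * (d + d)" using C d by (intro mult_strict_right_mono) auto
  also have "\<dots> = e" using C by (simp add: d_def)
  finally show ?case using bounded_lipschitz_cmult[OF g(1)] by blast
next
  case (add f1 f2)
  obtain g1 g2 where g: "bounded_lipschitz g1" "(\<integral>x. \<bar>f1 x - g1 x\<bar> \<partial>M) < e / 2"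
    "bounded_lipschitz g2" "(\<integral>x. \<bar>f2 x - g2 x\<bar> \<partial>M) < e / 2"
    using add.IH[of "e / 2"] add.prems by auto
  note ig = bounded_lipschitz_integrable[OF M sets g(1)] bounded_lipschitz_integrable[OF M sets g(3)]
  have "(\<integral>x. \<bar>f1 x + f2 x - (g1 x + g2 x)\<bar> \<partial>M) \<le> (\<integral>x. \<bar>f1 x - g1 x\<bar> + \<bar>f2 x - g2 x\<bar> \<partial>M)"
    using ig add.hyps by (intro integral_mono) auto
  also have "\<dots> < e" using ig add.hyps g by simp
  finally show ?case using bounded_lipschitz_add[OF g(1,3)] by blast
next
  case (lim f s)
  note [measurable] = borel_measurable_integrable[OF lim.hyps(1)] borel_measurable_integrable[OF lim.hyps(4)]
  have "(\<lambda>n. \<integral>x. \<bar>f x - s n x\<bar> \<partial>M) \<longlonglongrightarrow> (\<integral>x. 0 \<partial>M)"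
  proof (rule integral_dominated_convergence[where w = "\<lambda>x. 3 * \<bar>f x\<bar>"])
    show "AE x in M. (\<lambda>n. \<bar>f x - s n x\<bar>) \<longlonglongrightarrow> 0"
    proof (rule AE_I2)
      fix x assume "x \<in> space M"
      then have "(\<lambda>n. \<bar>f x - s n x\<bar>) \<longlonglongrightarrow> \<bar>f x - f x\<bar>"
        by (intro tendsto_intros lim.hyps)
      then show "(\<lambda>n. \<bar>f x - s n x\<bar>) \<longlonglongrightarrow> 0" by simp
    qed
    show "AE x in M. norm \<bar>f x - s n x\<bar> \<le> 3 * \<bar>f x\<bar>" for n
    proof (rule AE_I2)
      fix x assume "x \<in> space M"
      from lim.hyps(3)[OF this, of n] show "norm \<bar>f x - s n x\<bar> \<le> 3 * \<bar>f x\<bar>" by simp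
    qed
  qed (use lim.hyps(4) in auto)
  then have "\<forall>\<^sub>F n in sequentially. (\<integral>x. \<bar>f x - s n x\<bar> \<partial>M) < e / 2"
    using lim.prems by (intro order_tendstoD) auto
  then obtain n where n: "(\<integral>x. \<bar>f x - s n x\<bar> \<partial>M) < e / 2" by (auto simp: eventually_sequentially)
  obtain g where g: "bounded_lipschitz g" "(\<integral>x. \<bar>s n x - g x\<bar> \<partial>M) < e / 2"
    using lim.IH[of "e / 2" n] lim.prems by auto
  note ig = bounded_lipschitz_integrable[OF M sets g(1)]
  have "(\<integral>x. \<bar>f x - g x\<bar> \<partial>M) \<le> (\<integral>x. \<bar>f x - s n x\<bar> + \<bar>s n x - g x\<bar> \<partial>M)"
    using ig lim.hyps by (intro integral_mono) auto
  also have "\<dots> < e" using ig lim.hyps n g by simp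
  finally show ?case using g(1) by blast
qed

text \<open>
  The mixture $(\mu + \nu) / 2$, obtained by choosing one of the two measures with a fair coin. An
  approximation in $L^1$ of the mixture is one in $L^1(\mu)$ and in $L^1(\nu)$ at the same time.
\<close>

lemma dominating_finite_measure:
  fixes \<mu> \<nu> :: "'a measure"
  assumes "prob_space \<mu>" "prob_space \<nu>" and sets: "sets \<mu> = sets \<nu>"
  obtains M where "finite_measure M" "sets M = sets \<nu>"
    "\<And>f. f \<in> borel_measurable \<nu> \<Longrightarrow> (\<integral>\<^sup>+x. f x \<partial>\<mu>) \<le> 2 * (\<integral>\<^sup>+x. f x \<partial>M)"
    "\<And>f. f \<in> borel_measurable \<nu> \<Longrightarrow> (\<integral>\<^sup>+x. f x \<partial>\<nu>) \<le> 2 * (\<integral>\<^sup>+x. f x \<partial>M)"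
proof -
  interpret M: prob_space \<mu> by fact
  interpret N: prob_space \<nu> by fact
  let ?coin = "measure_pmf (bernoulli_pmf (1 / 2))"
  let ?k = "\<lambda>b. if b then \<mu> else \<nu>"
  define M where "M = ?coin \<bind> ?k"
  have k: "?k \<in> ?coin \<rightarrow>\<^sub>M subprob_algebra \<nu>"
    using sets M.subprob_space_axioms N.subprob_space_axioms
    by (auto simp: space_subprob_algebra)
  have sM: "sets M = sets \<nu>" unfolding M_def by (rule sets_bind[OF sets_kernel[OF k]]) auto
  have nn: "(\<integral>\<^sup>+x. f x \<partial>M) = (\<integral>\<^sup>+x. f x \<partial>\<mu>) / 2 + (\<integral>\<^sup>+x. f x \<partial>\<nu>) / 2"
    if f: "f \<in> borel_measurable \<nu>" for f
    unfolding M_def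
    by (subst nn_integral_bind[OF f k]) (simp add: nn_integral_bernoulli_pmf divide_ennreal_def ennreal_divide_numeral mult.commute)
  have "emeasure M (space M) = (\<integral>\<^sup>+x. 1 \<partial>M)" by simp
  also have "\<dots> < \<infinity>"
    by (subst nn) (auto simp: M.emeasure_space_1 N.emeasure_space_1 less_top[symmetric] ennreal_divide_eq_top_iff)
  finally have fin: "finite_measure M" by (intro finite_measureI) auto
  have two: "2 * (x / 2) = x" for x :: ennreal
    by (simp add: ennreal_times_divide mult.commute[of 2] ennreal_mult_divide_eq)
  show ?thesis
  proof (rule that[OF fin sM])
    fix f :: "'a \<Rightarrow> ennreal" assume f: "f \<in> borel_measurable \<nu>"
    show "(\<integral>\<^sup>+x. f x \<partial>\<mu>) \<le> 2 * (\<integral>\<^sup>+x. f x \<partial>M)" "(\<integral>\<^sup>+x. f x \<partial>\<nu>) \<le> 2 * (\<integral>\<^sup>+x. f x \<partial>M)"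
      unfolding nn[OF f] distrib_left two by auto
  qed
qed

lemma exp_le_exp_add_mult_abs_diff:
  fixes a b K :: real assumes "b \<le> K" shows "exp b \<le> exp a + exp K * \<bar>a - b\<bar>"
proof -
  have "exp b * (1 + (a - b)) \<le> exp b * exp (a - b)"
    by (intro mult_left_mono exp_ge_add_one_self) auto
  then have "exp b \<le> exp a + exp b * (b - a)"
    by (simp add: exp_diff algebra_simps)
  also have "exp b * (b - a) \<le> exp K * \<bar>a - b\<bar>"
  proof (rule order_trans)
    show "exp b * (b - a) \<le> exp b * \<bar>a - b\<bar>" by (intro mult_left_mono) auto
    show "exp b * \<bar>a - b\<bar> \<le> exp K * \<bar>a - b\<bar>" using assms by (intro mult_right_mono) auto
  qed
  finally show ?thesis by simp
qed

text \<open>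
  The functional $\int \Phi\,d\mu - \ln \int e^\Phi\,d\nu$ is continuous in $L^1(\mu) \cap L^1(\nu)$ on
  functions with a common bound. Hence the bounded Lipschitz functions, after truncation to the bound
  of \<open>\<Phi>\<close>, give the same supremum as all bounded measurable functions.
\<close>

theorem relative_entropy_le_bounded_lipschitz:
  fixes \<mu> \<nu> :: "'a::polish_space measure"
  assumes \<mu>: "prob_space \<mu>" and \<nu>: "prob_space \<nu>"
    and sets: "sets \<mu> = sets borel" "sets \<nu> = sets borel"
    and dual: "\<And>g. bounded_lipschitz g \<Longrightarrow> (\<integral>x. g x \<partial>\<mu>) - ln (\<integral>x. exp (g x) \<partial>\<nu>) \<le> c"
  shows "relative_entropy \<mu> \<nu> \<le> ereal c"
proof (rule relative_entropy_le_Donsker_Varadhan[OF \<mu> \<nu>])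
  show "sets \<mu> = sets \<nu>" using sets by simp
  fix \<Phi> :: "'a \<Rightarrow> real" and K
  assume \<Phi>: "\<Phi> \<in> borel_measurable \<nu>" and K: "\<bar>\<Phi> x\<bar> \<le> K" for x
  interpret M: prob_space \<mu> by fact
  interpret N: prob_space \<nu> by fact
  note mc = measurable_cong_sets[OF sets(1) refl] measurable_cong_sets[OF sets(2) refl]
  have [measurable]: "\<Phi> \<in> borel_measurable borel" using \<Phi> mc by blast
  obtain M where M: "finite_measure M" "sets M = sets borel"
    and le\<mu>: "\<And>f. f \<in> borel_measurable borel \<Longrightarrow> (\<integral>\<^sup>+x. f x \<partial>\<mu>) \<le> 2 * (\<integral>\<^sup>+x. f x \<partial>M)"
    and le\<nu>: "\<And>f. f \<in> borel_measurable borel \<Longrightarrow> (\<integral>\<^sup>+x. f x \<partial>\<nu>) \<le> 2 * (\<integral>\<^sup>+x. f x \<partial>M)"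
    using dominating_finite_measure[OF \<mu> \<nu>] sets mc by metis
  interpret R: finite_measure M by fact
  note mcM = measurable_cong_sets[OF M(2) refl]
  have int: "integrable \<mu> f" "integrable \<nu> f" "integrable M f"
    if f: "f \<in> borel_measurable borel" "\<And>x. \<bar>f x\<bar> \<le> B" for f :: "'a \<Rightarrow> real" and B
    using f(2) f(1)[folded mc(1)] f(1)[folded mc(2)] f(1)[folded mcM]
    by (auto intro!: M.integrable_const_bound[where B = B] N.integrable_const_bound[where B = B]
        R.integrable_const_bound[where B = B])
  have le: "(\<integral>x. f x \<partial>\<mu>) \<le> 2 * (\<integral>x. f x \<partial>M)" "(\<integral>x. f x \<partial>\<nu>) \<le> 2 * (\<integral>x. f x \<partial>M)"
    if f: "f \<in> borel_measurable borel" "\<And>x. \<bar>f x\<bar> \<le> B" "\<And>x. 0 \<le> f x" for f :: "'a \<Rightarrow> real" and B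
  proof -
    have "(\<integral>x. f x \<partial>M) \<ge> 0" using f by simp
    then show "(\<integral>x. f x \<partial>\<mu>) \<le> 2 * (\<integral>x. f x \<partial>M)" "(\<integral>x. f x \<partial>\<nu>) \<le> 2 * (\<integral>x. f x \<partial>M)"
      using le\<mu>[of "\<lambda>x. ennreal (f x)"] le\<nu>[of "\<lambda>x. ennreal (f x)"] f
      by (auto simp: nn_integral_eq_integral int[of f B] ennreal_mult''[symmetric]
          ennreal_numeral[symmetric] simp del: ennreal_numeral)
  qed
  define Z where "Z = (\<integral>x. exp (\<Phi> x) \<partial>\<nu>)"
  have int_exp: "integrable \<nu> (\<lambda>x. exp (f x))"
    if "f \<in> borel_measurable borel" "\<And>x. \<bar>f x\<bar> \<le> K" for f
    using that(1) abs_le_D1[OF that(2)] by (intro int(2)[of "\<lambda>x. exp (f x)" "exp K"]) auto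
  have Z_pos: "0 < (\<integral>x. exp (f x) \<partial>\<nu>)"
    if "f \<in> borel_measurable borel" "\<And>x. \<bar>f x\<bar> \<le> K" for f
  proof -
    have "exp (- K) = (\<integral>x. exp (- K) \<partial>\<nu>)" using N.prob_space by simp
    also have "\<dots> \<le> (\<integral>x. exp (f x) \<partial>\<nu>)"
      using abs_le_D2[OF that(2)] int_exp[OF that] by (intro integral_mono) (auto simp: minus_le_iff)
    finally show ?thesis by (rule less_le_trans[OF exp_gt_zero])
  qed
  have Z: "0 < Z" unfolding Z_def by (rule Z_pos) (use K in auto)
  have K0: "0 \<le> K" using K[of undefined] by linarith
  have "(\<integral>x. \<Phi> x \<partial>\<mu>) \<le> c + ln Z + e" if "0 < e" for e
  proof -
    \<comment> \<open>An error of \<open>2 * d\<close> in both integrals changes the linear term by \<open>2 * d\<close>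
      and the logarithm by at most \<open>exp K * (2 * d) / Z\<close>.\<close>
    define C where "C = 1 + exp K / Z"
    define d where "d = e / (2 * C)"
    have "0 < C" using Z by (simp add: C_def add_pos_pos)
    then have d: "0 < d" "2 * d * C = e" using \<open>0 < e\<close> by (simp_all add: d_def)
    obtain g0 where g0: "bounded_lipschitz g0" "(\<integral>x. \<bar>\<Phi> x - g0 x\<bar> \<partial>M) < d"
      using bounded_lipschitz_dense_L1[OF M int(3)[of \<Phi> K, OF _ K] d(1)] by auto
    define g where "g x = max (- K) (min K (g0 x))" for x
    have bl: "bounded_lipschitz g" unfolding g_def by (rule bounded_lipschitz_clamp[OF g0(1)])
    have [measurable]: "g \<in> borel_measurable borel" "g0 \<in> borel_measurable borel"
      using bounded_lipschitz_borel_measurable bl g0(1) by auto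
    have gK: "\<bar>g x\<bar> \<le> K" for x using K0 by (auto simp: g_def)
    have diff: "\<bar>\<bar>\<Phi> x - g x\<bar>\<bar> \<le> 2 * K" for x using K[of x] gK[of x] by linarith
    have "(\<integral>x. \<bar>\<Phi> x - g x\<bar> \<partial>M) \<le> (\<integral>x. \<bar>\<Phi> x - g0 x\<bar> \<partial>M)"
    proof (rule integral_mono)
      fix x show "\<bar>\<Phi> x - g x\<bar> \<le> \<bar>\<Phi> x - g0 x\<bar>" using K[of x] by (auto simp: g_def max_def min_def)
    next
      show "integrable M (\<lambda>x. \<bar>\<Phi> x - g x\<bar>)" by (rule int(3)[OF _ diff]) simp
      show "integrable M (\<lambda>x. \<bar>\<Phi> x - g0 x\<bar>)"
        using bounded_lipschitz_integrable[OF M g0(1)] int(3)[of \<Phi> K, OF _ K] by simp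
    qed
    then have dM: "(\<integral>x. \<bar>\<Phi> x - g x\<bar> \<partial>M) \<le> d" using g0(2) by linarith
    have d\<mu>: "(\<integral>x. \<bar>\<Phi> x - g x\<bar> \<partial>\<mu>) \<le> 2 * d" and d\<nu>: "(\<integral>x. \<bar>\<Phi> x - g x\<bar> \<partial>\<nu>) \<le> 2 * d"
      using le[of "\<lambda>x. \<bar>\<Phi> x - g x\<bar>", OF _ diff] dM by auto
    have "(\<integral>x. \<Phi> x \<partial>\<mu>) \<le> (\<integral>x. g x + \<bar>\<Phi> x - g x\<bar> \<partial>\<mu>)"
    proof (rule integral_mono)
      show "integrable \<mu> \<Phi>" by (rule int(1)[of \<Phi> K]) (use K in auto)
      show "integrable \<mu> (\<lambda>x. g x + \<bar>\<Phi> x - g x\<bar>)"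
        by (intro Bochner_Integration.integrable_add int(1)[OF _ gK] int(1)[OF _ diff]) auto
    qed auto
    also have "\<dots> = (\<integral>x. g x \<partial>\<mu>) + (\<integral>x. \<bar>\<Phi> x - g x\<bar> \<partial>\<mu>)"
      by (intro Bochner_Integration.integral_add int(1)[OF _ gK] int(1)[OF _ diff]) auto
    also have "\<dots> \<le> c + ln (\<integral>x. exp (g x) \<partial>\<nu>) + 2 * d"
      using dual[OF bl] d\<mu> by linarith
    also have "ln (\<integral>x. exp (g x) \<partial>\<nu>) \<le> ln Z + exp K * (2 * d) / Z"
    proof -
      have i: "integrable \<nu> (\<lambda>x. exp (g x))" "integrable \<nu> (\<lambda>x. exp (\<Phi> x))"
        by (rule int_exp; use K gK in simp)+
      have id: "integrable \<nu> (\<lambda>x. \<bar>\<Phi> x - g x\<bar>)" by (rule int(2)[OF _ diff]) simp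
      have "(\<integral>x. exp (g x) \<partial>\<nu>) \<le> (\<integral>x. exp (\<Phi> x) + exp K * \<bar>\<Phi> x - g x\<bar> \<partial>\<nu>)"
      proof (rule integral_mono)
        fix x show "exp (g x) \<le> exp (\<Phi> x) + exp K * \<bar>\<Phi> x - g x\<bar>"
          using gK[of x] by (intro exp_le_exp_add_mult_abs_diff) auto
      qed (use i id in auto)
      also have "\<dots> = Z + exp K * (\<integral>x. \<bar>\<Phi> x - g x\<bar> \<partial>\<nu>)"
        using i id by (simp add: Z_def)
      also have "\<dots> \<le> Z + exp K * (2 * d)"
        using d\<nu> by (intro add_left_mono mult_left_mono) auto
      also have "\<dots> = Z * (1 + exp K * (2 * d) / Z)" using Z by (simp add: field_simps)
      finally have "ln (\<integral>x. exp (g x) \<partial>\<nu>) \<le> ln (Z * (1 + exp K * (2 * d) / Z))"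
        using Z_pos[OF _ gK] by (intro ln_mono) auto
      also have "\<dots> = ln Z + ln (1 + exp K * (2 * d) / Z)"
        using Z d(1) by (intro ln_mult_pos) (auto intro!: add_pos_pos)
      also have "\<dots> \<le> ln Z + exp K * (2 * d) / Z"
        using Z d(1) by (intro add_left_mono ln_add_one_self_le_self) auto
      finally show ?thesis .
    qed
    finally have "(\<integral>x. \<Phi> x \<partial>\<mu>) \<le> c + ln Z + 2 * d * C"
      by (simp add: C_def algebra_simps)
    then show ?thesis using d(2) by simp
  qed
  then have "(\<integral>x. \<Phi> x \<partial>\<mu>) \<le> c + ln Z" by (rule field_le_epsilon)
  then show "(\<integral>x. \<Phi> x \<partial>\<mu>) - ln (\<integral>x. exp (\<Phi> x) \<partial>\<nu>) \<le> c" by (simp add: Z_def)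
qed

section \<open>Scaling of Lebesgue measure\<close>

lemma restrict_scale_in_borel_Rn[measurable]:
  "(\<lambda>v. \<lambda>i\<in>{..<N}. r * v i) \<in> borel_Rn N \<rightarrow>\<^sub>M borel_Rn N"
  unfolding borel_Rn_def by measurable

lemma L2_set_restrict_scale:
  assumes "0 \<le> r"
  shows "L2_set (\<lambda>i\<in>{..<N}. r * v i) {..<N} = r * L2_set v {..<N}"
proof -
  have "L2_set (\<lambda>i\<in>{..<N}. r * v i) {..<N} = L2_set (\<lambda>i. r * v i) {..<N}"
    by (rule L2_set_cong) auto
  then show ?thesis using L2_set_right_distrib[OF assms, of v] by simp
qed

text \<open>
  Lebesgue measure and its rescaled image need only be compared on boxes, where the claim is the scaling
  of Lebesgue measure on the line in each of the \<open>N\<close> coordinates.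
\<close>

lemma nn_integral_lborel_Rn_scale:
  assumes r: "0 < r" and f: "f \<in> borel_measurable (borel_Rn N)"
  shows "(\<integral>\<^sup>+v. f v \<partial>lborel_Rn N)
    = ennreal (r ^ N) * (\<integral>\<^sup>+v. f (\<lambda>i\<in>{..<N}. r * v i) \<partial>lborel_Rn N)"
proof -
  interpret product_sigma_finite "\<lambda>_::nat. lborel::real measure" by standard
  let ?S = "\<lambda>v. \<lambda>i\<in>{..<N}. r * v i"
  define P where "P = scale_measure (ennreal (r ^ N)) (distr (lborel_Rn N) (borel_Rn N) ?S)"
  have S_m: "?S \<in> lborel_Rn N \<rightarrow>\<^sub>M borel_Rn N"
    using restrict_scale_in_borel_Rn measurable_cong_sets[OF sets_lborel_Rn refl] by blast
  have "P = (\<Pi>\<^sub>M i\<in>{..<N}. lborel)"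
  proof (rule PiM_eqI)
    show "sets P = sets (Pi\<^sub>M {..<N} (\<lambda>_. lborel))"
      by (simp add: P_def sets_lborel_Rn[symmetric] lborel_Rn_def)
  next
    fix A :: "nat \<Rightarrow> real set" assume A: "\<And>i. i \<in> {..<N} \<Longrightarrow> A i \<in> sets lborel"
    have pre: "{x. r * x \<in> A i} \<in> sets lborel" if "i < N" for i
      using measurable_sets[of "\<lambda>x. r * x" borel borel "A i"] A[of i] that by (simp add: vimage_def)
    have one: "ennreal r * emeasure lborel {x. r * x \<in> A i} = emeasure lborel (A i)" if i: "i < N" for i
    proof -
      have "emeasure lborel (A i) = (\<integral>\<^sup>+x. indicator (A i) x \<partial>lborel)"
        using A i by simp
      also have "\<dots> = ennreal r * (\<integral>\<^sup>+x. indicator (A i) (0 + r * x) \<partial>lborel)"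
        using r A[of i] i by (subst nn_integral_real_affine[of _ r 0]) auto
      also have "(\<integral>\<^sup>+x. indicator (A i) (0 + r * x) \<partial>lborel) = (\<integral>\<^sup>+x. indicator {x. r * x \<in> A i} x \<partial>lborel)"
        by (intro nn_integral_cong) (auto simp: indicator_def)
      finally show ?thesis using pre[OF i] by simp
    qed
    have PA: "Pi\<^sub>E {..<N} A \<in> sets (borel_Rn N)"
      unfolding borel_Rn_def using A by (intro sets_PiM_I_finite) auto
    have "?S -` Pi\<^sub>E {..<N} A \<inter> space (lborel_Rn N) = Pi\<^sub>E {..<N} (\<lambda>i. {x. r * x \<in> A i})"
      (is "?L = ?R")
    proof (rule set_eqI)
      fix v
      have "v \<in> ?L \<longleftrightarrow> (\<forall>i<N. r * v i \<in> A i) \<and> v \<in> extensional {..<N}"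
        by (auto simp: lborel_Rn_def space_PiM PiE_iff)
      also have "\<dots> \<longleftrightarrow> v \<in> ?R" by (auto simp: PiE_iff)
      finally show "v \<in> ?L \<longleftrightarrow> v \<in> ?R" .
    qed
    then have "emeasure P (Pi\<^sub>E {..<N} A)
        = ennreal (r ^ N) * emeasure (lborel_Rn N) (Pi\<^sub>E {..<N} (\<lambda>i. {x. r * x \<in> A i}))"
      using emeasure_distr[OF S_m PA] by (simp add: P_def)
    also have "\<dots> = ennreal (r ^ N) * (\<Prod>i<N. emeasure lborel {x. r * x \<in> A i})"
      unfolding lborel_Rn_def using pre by (subst emeasure_PiM) auto
    also have "\<dots> = (\<Prod>i<N. ennreal r * emeasure lborel {x. r * x \<in> A i})"
      using r by (simp add: prod.distrib ennreal_power)
    also have "\<dots> = (\<Prod>i<N. emeasure lborel (A i))"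
      by (intro prod.cong) (auto simp: one)
    finally show "emeasure P (Pi\<^sub>E {..<N} A) = (\<Prod>i\<in>{..<N}. emeasure lborel (A i))" .
  qed simp
  then have "(\<integral>\<^sup>+v. f v \<partial>lborel_Rn N) = (\<integral>\<^sup>+v. f v \<partial>P)" by (simp add: lborel_Rn_def)
  also have "\<dots> = ennreal (r ^ N) * (\<integral>\<^sup>+v. f v \<partial>distr (lborel_Rn N) (borel_Rn N) ?S)"
    unfolding P_def using f by (intro nn_integral_scale_measure) simp
  also have "(\<integral>\<^sup>+v. f v \<partial>distr (lborel_Rn N) (borel_Rn N) ?S) = (\<integral>\<^sup>+v. f (?S v) \<partial>lborel_Rn N)"
    by (subst nn_integral_distr[OF S_m]) (simp_all add: f)
  finally show ?thesis .
qed

section \<open>The volume of the ball of radius $\sqrt N$\<close>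

lemma ln_diff_ge:
  fixes a b :: real assumes "0 < b" "0 < a" shows "(a - b) / a \<le> ln a - ln b"
proof -
  have "ln (b / a) \<le> b / a - 1" using assms by (intro ln_le_minus_one) auto
  then show ?thesis using assms by (simp add: ln_div diff_divide_distrib)
qed

text \<open>
  Stirling's upper bound for $\Gamma(x + 1)$ with $x = N / 2$, up to a polynomial factor. The generous
  factor $(x + 1)^2$ lets an elementary induction from $x$ to $x + 1$ go through: after taking
  logarithms the step is
  $1 \le x (\ln (x + 1) - \ln x) + 2 (\ln (x + 2) - \ln (x + 1))$,
  which follows from $\ln a - \ln b \ge (a - b) / a$. As \<open>N\<close> advances by 2, there are two base cases.
\<close>

lemma Gamma_half_le_Stirling:
  assumes "1 \<le> N"
  shows "Gamma (real N / 2 + 1)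
    \<le> 2 * (real N / 2 + 1)\<^sup>2 * exp (real N / 2 * ln (real N / 2) - real N / 2)"
  using assms
proof (induction N rule: less_induct)
  case (less N)
  consider "N = 1" | "N = 2" | "3 \<le> N" using less.prems by linarith
  then show ?case
  proof cases
    case 1
    have e: "1 / 4 \<le> exp (1 / 2 * ln (1 / 2) - 1 / 2 :: real)"
    proof -
      have "ln (2::real) \<le> 1" using ln_le_minus_one[of "2::real"] by simp
      then have "1 / 2 * ln (1 / 2) - 1 / 2 \<ge> (- 1 :: real)" by (simp add: ln_div)
      then have "exp (- 1) \<le> exp (1 / 2 * ln (1 / 2) - 1 / 2 :: real)" by simp
      moreover have "(1 / 4 :: real) \<le> exp (- 1)" using exp_le by (simp add: exp_minus field_simps)
      ultimately show ?thesis by linarith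
    qed
    have "Gamma (1 / 2 + 1 :: real) = 1 / 2 * Gamma (1 / 2)"
      by (subst Gamma_plus1) (use nonpos_Ints_nonpos[of "1 / 2 :: real"] in auto)
    also have "\<dots> = sqrt pi / 2" by (simp add: Gamma_one_half_real)
    also have "\<dots> \<le> 1" using pi_less_4 real_sqrt_le_mono[of pi 4] by simp
    also have "\<dots> \<le> 2 * (1 / 2 + 1)\<^sup>2 * (1 / 4 :: real)" by (simp add: power2_eq_square)
    also have "\<dots> \<le> 2 * (1 / 2 + 1)\<^sup>2 * exp (1 / 2 * ln (1 / 2) - 1 / 2)"
      by (intro mult_left_mono e) simp
    finally show ?thesis using 1 by simp
  next
    case 2
    have "Gamma (1 + 1 :: real) = 1" using Gamma_fact[of 1, where 'a = real] by simp
    moreover have "(1 / 3 :: real) \<le> exp (- 1)" using exp_le by (simp add: exp_minus field_simps)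
    ultimately show ?thesis using 2 by simp
  next
    case 3
    define x where "x = real N / 2 - 1"
    have x: "0 < x" "real (N - 2) / 2 = x" "real N / 2 = x + 1" using 3 by (auto simp: x_def of_nat_diff)
    have IH: "Gamma (x + 1) \<le> 2 * (x + 1)\<^sup>2 * exp (x * ln x - x)"
      using less.IH[of "N - 2"] 3 x by simp
    have "Gamma (x + 1 + 1) = (x + 1) * Gamma (x + 1)"
      using x(1) by (intro Gamma_plus1) (auto elim!: nonpos_Ints_cases)
    also have "\<dots> \<le> (x + 1) * (2 * (x + 1)\<^sup>2 * exp (x * ln x - x))"
      using x(1) IH by (intro mult_left_mono) auto
    also have "\<dots> = 2 * exp (3 * ln (x + 1) + (x * ln x - x))"
      using x(1) by (simp add: exp_add exp_of_nat_mult[of 3, simplified] power3_eq_cube power2_eq_square)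
    also have "\<dots> \<le> 2 * exp (2 * ln (x + 2) + ((x + 1) * ln (x + 1) - (x + 1)))"
    proof -
      have "1 / (x + 1) \<le> ln (x + 1) - ln x" "1 / (x + 2) \<le> ln (x + 2) - ln (x + 1)"
        using ln_diff_ge[of x "x + 1"] ln_diff_ge[of "x + 1" "x + 2"] x(1) by auto
      then have "x * (1 / (x + 1)) + 2 * (1 / (x + 2))
          \<le> x * (ln (x + 1) - ln x) + 2 * (ln (x + 2) - ln (x + 1))"
        using x(1) by (intro add_mono mult_left_mono) auto
      moreover have "x * (1 / (x + 1)) + 2 * (1 / (x + 2)) = 1 + x / ((x + 1) * (x + 2))"
        using x(1) by (simp add: divide_simps) (simp add: algebra_simps)
      moreover have "0 \<le> x / ((x + 1) * (x + 2))" using x(1) by simp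
      ultimately have "1 \<le> x * (ln (x + 1) - ln x) + 2 * (ln (x + 2) - ln (x + 1))" by linarith
      then show ?thesis by (simp add: algebra_simps)
    qed
    also have "\<dots> = 2 * (x + 2)\<^sup>2 * exp ((x + 1) * ln (x + 1) - (x + 1))"
      using x(1) by (simp add: exp_add exp_of_nat_mult[of 2, simplified] power2_eq_square)
    finally show ?thesis unfolding x(3) by (simp add: add.assoc)
  qed
qed

text \<open>
  The denominator is the volume of the ball of radius $\sqrt N$, and the numerator is the reciprocal of
  the standard Gaussian density on its boundary. So uniform measure on this ball has a density that is
  at most a polynomial multiple of the Gaussian one, everywhere in the ball.
\<close>

lemma inverse_unit_ball_vol_le:
  assumes "1 \<le> N"
  shows "sqrt (2 * pi * exp 1) ^ N / (sqrt (real N) ^ N * unit_ball_vol (real N)) \<le> 2 * (real N / 2 + 1)\<^sup>2"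
proof -
  define x where "x = real N / 2"
  have x: "0 < x" using assms by (simp add: x_def)
  have sq: "sqrt a ^ N = exp (x * ln a)" if "0 < a" for a
  proof -
    have "exp (ln a / 2) = sqrt a" 
      using exp_ln[of "sqrt a"] that by (simp add: ln_sqrt)
    moreover have "x * ln a = real N * (ln a / 2)" by (simp add: x_def)
    ultimately show ?thesis by (simp only: exp_of_nat_mult)
  qed
  have "ln (2 * pi * exp 1) = ln 2 + ln pi + 1" by (simp add: ln_mult)
  moreover have "ln (real N) = ln 2 + ln x" using x by (simp add: x_def ln_div)
  moreover have "unit_ball_vol (real N) = exp (x * ln pi) / Gamma (x + 1)"
    by (simp add: unit_ball_vol_def x_def powr_def)
  ultimately have "sqrt (2 * pi * exp 1) ^ N / (sqrt (real N) ^ N * unit_ball_vol (real N))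
      = exp (x * (ln 2 + ln pi + 1)) / (exp (x * (ln 2 + ln x)) * (exp (x * ln pi) / Gamma (x + 1)))"
    using assms by (simp add: sq)
  also have "\<dots> = Gamma (x + 1) * exp (x - x * ln x)"
    using x by (simp add: exp_diff exp_add exp_minus distrib_left field_simps)
  also have "\<dots> \<le> (2 * (x + 1)\<^sup>2 * exp (x * ln x - x)) * exp (x - x * ln x)"
    using Gamma_half_le_Stirling[OF assms] by (intro mult_right_mono) (auto simp: x_def)
  also have "\<dots> = 2 * (x + 1)\<^sup>2" by (simp add: mult.assoc exp_add[symmetric])
  finally show ?thesis by (simp add: x_def)
qed

section \<open>The Laplace transform of an additive function on the sphere\<close>

text \<open>
  If $\varrho = |v|$, the projection moves coordinate $i$ by $|v_i| (\sqrt N / \varrho - 1)$. By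
  Cauchy--Schwarz $\sum_i |v_i| \le \sqrt N \varrho$, so the coordinates move by at most
  $\sqrt N (\sqrt N - \varrho)$ in total, which is at most $1$ in a shell of relative width $1 / N$.
\<close>

lemma sum_radial_projection_le:
  assumes L: "L-lipschitz_on UNIV \<phi>" and N: "2 \<le> N"
    and v: "(1 - 1 / real N) * sqrt (real N) < L2_set v {..<N}" "L2_set v {..<N} \<le> sqrt (real N)"
  shows "(\<Sum>i<N. \<phi> (radial_projection N v i)) \<le> (\<Sum>i<N. \<phi> (v i)) + L"
proof -
  define \<rho> where "\<rho> = L2_set v {..<N}"
  define s where "s = sqrt (real N)"
  have s: "0 < s" "s * s = real N" using N by (auto simp: s_def)
  have "0 \<le> (1 - 1 / real N) * s" using N s by (intro mult_nonneg_nonneg) auto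
  then have \<rho>: "0 < \<rho>" "\<rho> \<le> s" "(1 - 1 / real N) * s < \<rho>"
    using v by (auto simp: \<rho>_def s_def)
  have L0: "0 \<le> L" by (rule lipschitz_on_nonneg[OF L])
  have "(\<Sum>i<N. \<phi> (radial_projection N v i)) \<le> (\<Sum>i<N. \<phi> (v i) + L * ((s / \<rho> - 1) * \<bar>v i\<bar>))"
  proof (rule sum_mono)
    fix i assume "i \<in> {..<N}"
    then have p: "radial_projection N v i = s * v i / \<rho>"
      by (simp add: radial_projection_def s_def \<rho>_def)
    have "\<phi> (radial_projection N v i) - \<phi> (v i) \<le> L * \<bar>radial_projection N v i - v i\<bar>"
      using lipschitz_onD[OF L, of "radial_projection N v i" "v i"] by (simp add: dist_real_def)
    also have "radial_projection N v i - v i = (s / \<rho> - 1) * v i"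
      unfolding p by (simp add: algebra_simps)
    also have "\<bar>(s / \<rho> - 1) * v i\<bar> = (s / \<rho> - 1) * \<bar>v i\<bar>"
      using \<rho> by (simp add: abs_mult)
    finally show "\<phi> (radial_projection N v i) \<le> \<phi> (v i) + L * ((s / \<rho> - 1) * \<bar>v i\<bar>)" by simp
  qed
  also have "\<dots> = (\<Sum>i<N. \<phi> (v i)) + L * ((s / \<rho> - 1) * (\<Sum>i<N. \<bar>v i\<bar>))"
    by (simp add: sum.distrib sum_distrib_left)
  also have "L * ((s / \<rho> - 1) * (\<Sum>i<N. \<bar>v i\<bar>)) \<le> L * ((s / \<rho> - 1) * (s * \<rho>))"
  proof -
    have "(\<Sum>i<N. \<bar>1\<bar> * \<bar>v i\<bar>) \<le> L2_set (\<lambda>_. 1) {..<N} * L2_set v {..<N}"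
      by (rule L2_set_mult_ineq)
    then have "(\<Sum>i<N. \<bar>v i\<bar>) \<le> s * \<rho>" by (simp add: L2_set_def s_def \<rho>_def)
    then show ?thesis using \<rho> L0 by (intro mult_left_mono) auto
  qed
  also have "(s / \<rho> - 1) * (s * \<rho>) = s * (s - \<rho>)" using \<rho> by (simp add: field_simps)
  also have "L * (s * (s - \<rho>)) \<le> L * 1"
  proof (rule mult_left_mono[OF _ L0])
    have "s - \<rho> \<le> s / real N" using \<rho>(3) by (simp add: algebra_simps)
    then have "s * (s - \<rho>) \<le> s * (s / real N)" using s by (intro mult_left_mono) auto
    also have "\<dots> = 1" using s N by simp
    finally show "s * (s - \<rho>) \<le> 1" .
  qed
  finally show ?thesis by simp
qed

text \<open>
  In the ball of radius $\sqrt N$ the Gaussian density is at least $(2 \pi e)^{-N/2}$. So Lebesgue measure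
  can be replaced by the Gaussian measure, for which the integral factorises.
\<close>

lemma nn_integral_ball_le_gaussian:
  assumes [measurable]: "\<phi> \<in> borel_measurable borel"
  shows "(\<integral>\<^sup>+v. ennreal (exp (\<Sum>i<N. \<phi> (v i))) * indicator {v. L2_set v {..<N} \<le> sqrt (real N)} v \<partial>lborel_Rn N)
    \<le> (ennreal (sqrt (2 * pi * exp 1)) * (\<integral>\<^sup>+x. ennreal (exp (\<phi> x)) \<partial>std_gaussian)) ^ N"
proof -
  interpret product_sigma_finite "\<lambda>_::nat. lborel::real measure" by standard
  define \<psi> where "\<psi> x = exp (\<phi> x) * (sqrt (2 * pi * exp 1) * (exp (- x\<^sup>2 / 2) / sqrt (2 * pi)))" for x
  have [measurable]: "\<psi> \<in> borel_measurable borel" unfolding \<psi>_def by measurable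
  have \<psi>0: "0 \<le> \<psi> x" for x by (simp add: \<psi>_def)
  have \<psi>_exp: "\<psi> x = exp (\<phi> x + (1 - x\<^sup>2) / 2)" for x
  proof -
    have "sqrt (exp 1) = exp (1 / 2)" by (rule real_sqrt_unique) (simp_all add: power2_eq_square exp_add[symmetric])
    moreover have "\<psi> x = exp (\<phi> x) * (sqrt (exp 1) * exp (- x\<^sup>2 / 2))"
      by (simp add: \<psi>_def real_sqrt_mult)
    ultimately have "\<psi> x = exp (\<phi> x + (1 / 2 + - x\<^sup>2 / 2))" by (simp only: exp_add)
    also have "1 / 2 + - x\<^sup>2 / 2 = (1 - x\<^sup>2) / 2" by (simp add: diff_divide_distrib)
    finally show ?thesis .
  qed
  have "(\<integral>\<^sup>+v. ennreal (exp (\<Sum>i<N. \<phi> (v i))) * indicator {v. L2_set v {..<N} \<le> sqrt (real N)} v \<partial>lborel_Rn N)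
      \<le> (\<integral>\<^sup>+v. (\<Prod>i<N. ennreal (\<psi> (v i))) \<partial>lborel_Rn N)"
  proof (rule nn_integral_mono)
    fix v :: "nat \<Rightarrow> real"
    show "ennreal (exp (\<Sum>i<N. \<phi> (v i))) * indicator {v. L2_set v {..<N} \<le> sqrt (real N)} v
        \<le> (\<Prod>i<N. ennreal (\<psi> (v i)))"
    proof (cases "L2_set v {..<N} \<le> sqrt (real N)")
      case True
      then have "(\<Sum>i<N. (v i)\<^sup>2) \<le> real N" by (simp add: L2_set_def)
      then have "(\<Sum>i<N. \<phi> (v i)) \<le> (\<Sum>i<N. \<phi> (v i)) + (real N - (\<Sum>i<N. (v i)\<^sup>2)) / 2" by simp
      also have "\<dots> = (\<Sum>i<N. \<phi> (v i) + (1 - (v i)\<^sup>2) / 2)"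
        by (simp add: sum.distrib sum_subtractf sum_divide_distrib[symmetric])
      finally have "exp (\<Sum>i<N. \<phi> (v i)) \<le> (\<Prod>i<N. \<psi> (v i))"
        unfolding \<psi>_exp exp_sum[OF finite_lessThan, symmetric] by simp
      then show ?thesis using True \<psi>0 by (simp add: prod_ennreal ennreal_leI)
    qed simp
  qed
  also have "\<dots> = (\<Prod>i<N. \<integral>\<^sup>+x. ennreal (\<psi> x) \<partial>lborel)"
    unfolding lborel_Rn_def by (rule product_nn_integral_prod) auto
  also have "(\<integral>\<^sup>+x. ennreal (\<psi> x) \<partial>lborel)
      = ennreal (sqrt (2 * pi * exp 1)) * (\<integral>\<^sup>+x. ennreal (exp (\<phi> x)) \<partial>std_gaussian)"
  proof -
    have "(\<integral>\<^sup>+x. ennreal (\<psi> x) \<partial>lborel) = (\<integral>\<^sup>+x. ennreal (sqrt (2 * pi * exp 1)) *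
        (ennreal (exp (- x\<^sup>2 / 2) / sqrt (2 * pi)) * ennreal (exp (\<phi> x))) \<partial>lborel)"
      by (intro nn_integral_cong) (simp add: \<psi>_def ennreal_mult'[symmetric] mult_ac)
    also have "\<dots> = ennreal (sqrt (2 * pi * exp 1)) *
        (\<integral>\<^sup>+x. ennreal (exp (- x\<^sup>2 / 2) / sqrt (2 * pi)) * ennreal (exp (\<phi> x)) \<partial>lborel)"
      by (rule nn_integral_cmult) measurable
    also have "(\<integral>\<^sup>+x. ennreal (exp (- x\<^sup>2 / 2) / sqrt (2 * pi)) * ennreal (exp (\<phi> x)) \<partial>lborel)
        = (\<integral>\<^sup>+x. ennreal (exp (\<phi> x)) \<partial>std_gaussian)"
      unfolding std_gaussian_def by (subst nn_integral_density) auto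
    finally show ?thesis .
  qed
  also have "(\<Prod>i<N. ennreal (sqrt (2 * pi * exp 1)) * (\<integral>\<^sup>+x. ennreal (exp (\<phi> x)) \<partial>std_gaussian))
    = (ennreal (sqrt (2 * pi * exp 1)) * (\<integral>\<^sup>+x. ennreal (exp (\<phi> x)) \<partial>std_gaussian)) ^ N" by simp
  finally show ?thesis .
qed

text \<open>
  The inequality comes from the restriction of the projected measure to the sphere, which can only
  decrease the integral of a nonnegative function.
\<close>

lemma nn_integral_sphere_uniform_le:
  assumes f[measurable]: "f \<in> borel_measurable (borel_Rn N)"
  shows "(\<integral>\<^sup>+w. f w \<partial>sphere_uniform N)
    \<le> (\<integral>\<^sup>+v. f (radial_projection N v) * indicator (unit_ball_Rn N) v \<partial>lborel_Rn N)
        / ennreal (unit_ball_vol (real N))"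
proof -
  let ?U = "uniform_measure (lborel_Rn N) (unit_ball_Rn N)"
  note mc = measurable_cong_sets[OF sets_lborel_Rn refl]
  have U: "radial_projection N \<in> ?U \<rightarrow>\<^sub>M borel_Rn N"
    using measurable_radial_projection[folded mc] by simp
  have "(\<integral>\<^sup>+w. f w \<partial>sphere_uniform N)
      = (\<integral>\<^sup>+w. f w * indicator (kac_sphere N) w \<partial>distr ?U (borel_Rn N) (radial_projection N))"
    unfolding sphere_uniform_def by (subst nn_integral_restrict_space) auto
  also have "\<dots> \<le> (\<integral>\<^sup>+w. f w \<partial>distr ?U (borel_Rn N) (radial_projection N))"
    by (intro nn_integral_mono) (auto simp: indicator_def)
  also have "\<dots> = (\<integral>\<^sup>+v. f (radial_projection N v) \<partial>?U)"
    by (subst nn_integral_distr[OF U]) auto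
  also have "\<dots> = (\<integral>\<^sup>+v. f (radial_projection N v) * indicator (unit_ball_Rn N) v \<partial>lborel_Rn N)
      / emeasure (lborel_Rn N) (unit_ball_Rn N)"
    using measurable_compose[OF measurable_radial_projection f, folded mc]
    by (subst nn_integral_uniform_measure) (auto simp: sets_lborel_Rn)
  finally show ?thesis by (simp add: emeasure_unit_ball_Rn)
qed

lemma radial_projection_restrict_scale:
  assumes "0 < r"
  shows "radial_projection N (\<lambda>i\<in>{..<N}. r * v i) = radial_projection N v"
  using assms by (auto simp: radial_projection_def L2_set_restrict_scale)

lemma restrict_in_borel_Rn: "(\<lambda>i\<in>{..<N}. f i) \<in> space (borel_Rn N)"
  by (simp add: borel_Rn_def space_PiM)

lemma one_minus_inverse_power_le_half:
  assumes "2 \<le> N" shows "(1 - 1 / real N) ^ N \<le> 1 / 2"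
proof -
  have "1 + (- 1 / real N) \<le> exp (- 1 / real N)" by (rule exp_ge_add_one_self)
  then have "(1 - 1 / real N) ^ N \<le> exp (- 1 / real N) ^ N"
    using assms by (intro power_mono) auto
  also have "\<dots> = exp (- 1)" using assms by (simp add: exp_of_nat_mult[symmetric])
  also have "\<dots> \<le> 1 / 2" using exp_ge_add_one_self[of "1::real"] by (simp add: exp_minus field_simps)
  finally show ?thesis .
qed

text \<open>
  A function that is constant on rays has over the ball of radius $r = 1 - 1/N$ the integral $r^N$ times
  the one over the unit ball. Since $r^N \le 1/2$, at least half of the integral comes from the outer shell;
  the bound on the function makes the integral finite, so that the inner part can be absorbed.
\<close>

lemma nn_integral_ball_le_shell:
  assumes N: "2 \<le> N" and f[measurable]: "f \<in> borel_measurable (borel_Rn N)"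
    and bound: "\<And>v. f v \<le> ennreal C"
    and homogeneous: "\<And>r v. 0 < r \<Longrightarrow> f (\<lambda>i\<in>{..<N}. r * v i) = f v"
  shows "(\<integral>\<^sup>+v. f v * indicator (unit_ball_Rn N) v \<partial>lborel_Rn N)
    \<le> 2 * (\<integral>\<^sup>+v. f v * indicator {v \<in> unit_ball_Rn N. 1 - 1 / real N < L2_set v {..<N}} v \<partial>lborel_Rn N)"
proof -
  define r where "r = 1 - 1 / real N"
  have r: "0 < r" "r \<le> 1" using N by (auto simp: r_def)
  let ?B = "unit_ball_Rn N" and ?I = "{v \<in> unit_ball_Rn N. L2_set v {..<N} \<le> r}"
    and ?S = "{v \<in> unit_ball_Rn N. r < L2_set v {..<N}}"
  define J where "J = (\<integral>\<^sup>+v. f v * indicator ?B v \<partial>lborel_Rn N)"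
  define S where "S = (\<integral>\<^sup>+v. f v * indicator ?S v \<partial>lborel_Rn N)"
  note mc = measurable_cong_sets[OF sets_lborel_Rn refl]
  have I_eq: "?I = {v \<in> space (borel_Rn N). L2_set v {..<N} \<le> 1 \<and> L2_set v {..<N} \<le> r}"
    and S_eq: "?S = {v \<in> space (borel_Rn N). L2_set v {..<N} \<le> 1 \<and> r < L2_set v {..<N}}"
    by (auto simp: unit_ball_Rn_def)
  have [measurable]: "?I \<in> sets (borel_Rn N)" "?S \<in> sets (borel_Rn N)"
    unfolding I_eq S_eq by measurable
  have "J \<le> (\<integral>\<^sup>+v. ennreal C * indicator ?B v \<partial>lborel_Rn N)"
    unfolding J_def by (intro nn_integral_mono mult_right_mono bound) auto
  also have "\<dots> = ennreal C * emeasure (lborel_Rn N) ?B"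
    by (rule nn_integral_cmult_indicator) (simp add: sets_lborel_Rn)
  also have "\<dots> < \<infinity>" by (simp add: emeasure_unit_ball_Rn ennreal_mult_less_top)
  finally have J_fin: "J < \<infinity>" .
  have "J = (\<integral>\<^sup>+v. f v * indicator ?I v + f v * indicator ?S v \<partial>lborel_Rn N)"
    unfolding J_def by (intro nn_integral_cong) (auto simp: indicator_def)
  also have "\<dots> = (\<integral>\<^sup>+v. f v * indicator ?I v \<partial>lborel_Rn N) + S"
    unfolding S_def by (rule nn_integral_add) (simp_all add: mc)
  also have "(\<integral>\<^sup>+v. f v * indicator ?I v \<partial>lborel_Rn N)
      = ennreal (r ^ N) * (\<integral>\<^sup>+v. f (\<lambda>i\<in>{..<N}. r * v i) * indicator ?I (\<lambda>i\<in>{..<N}. r * v i) \<partial>lborel_Rn N)"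
    by (rule nn_integral_lborel_Rn_scale[OF r(1)]) measurable
  also have "(\<integral>\<^sup>+v. f (\<lambda>i\<in>{..<N}. r * v i) * indicator ?I (\<lambda>i\<in>{..<N}. r * v i) \<partial>lborel_Rn N) = J"
    unfolding J_def
  proof (rule nn_integral_cong)
    fix v assume "v \<in> space (lborel_Rn N)"
    then have v: "v \<in> space (borel_Rn N)" using sets_eq_imp_space_eq[OF sets_lborel_Rn] by simp
    have "r * L2_set v {..<N} \<le> r \<longleftrightarrow> L2_set v {..<N} \<le> 1" using r by simp
    moreover have "r * L2_set v {..<N} \<le> 1" if "L2_set v {..<N} \<le> 1"
      using r that by (intro mult_le_one) auto
    ultimately have "(\<lambda>i\<in>{..<N}. r * v i) \<in> ?I \<longleftrightarrow> v \<in> ?B"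
      using r v restrict_in_borel_Rn[of "\<lambda>i. r * v i" N]
      by (auto simp: unit_ball_Rn_def L2_set_restrict_scale)
    then show "f (\<lambda>i\<in>{..<N}. r * v i) * indicator ?I (\<lambda>i\<in>{..<N}. r * v i) = f v * indicator ?B v"
      using homogeneous[OF r(1)] by (simp add: indicator_def)
  qed
  finally have eq: "J = ennreal (r ^ N) * J + S" .
  have "r ^ N \<le> 1 / 2" using one_minus_inverse_power_le_half[OF N] by (simp add: r_def)
  moreover obtain j where j: "J = ennreal j" "0 \<le> j" using J_fin by (cases J) auto
  moreover have "S \<le> J" using eq by (metis add.commute le_iff_add)
  then obtain s where s: "S = ennreal s" "0 \<le> s" using J_fin by (cases S) (auto simp: top_unique)
  ultimately have "j = r ^ N * j + s"
    using eq r by (simp add: ennreal_mult'[symmetric] ennreal_plus[symmetric] del: ennreal_plus)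
  also have "r ^ N * j \<le> 1 / 2 * j" using \<open>r ^ N \<le> 1 / 2\<close> j by (intro mult_right_mono)
  finally have "j \<le> 2 * s" by simp
  then have "J \<le> 2 * S" using j s by (simp add: ennreal_mult'[symmetric] flip: ennreal_numeral)
  then show ?thesis by (simp add: J_def S_def r_def)
qed

text \<open>
  The uniform measure on the sphere is the projection of the uniform measure on the ball, and a thin outer
  shell carries at least half of an integral over the ball that depends on directions alone. Rescaling brings the shell to radius $\sqrt N$. There the
  projection changes the exponent by at most \<open>L\<close>, and Lebesgue measure is dominated by the Gaussian
  measure. The constants cancel up to a polynomial factor by the estimate of the volume of the ball.
\<close>

theorem sphere_laplace_le_gaussian:
  assumes L: "L-lipschitz_on UNIV \<phi>" and K: "\<And>x. \<bar>\<phi> x\<bar> \<le> K" and N: "2 \<le> N"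
  shows "(\<integral>\<^sup>+w. ennreal (exp (\<Sum>i<N. \<phi> (w i))) \<partial>sphere_uniform N)
    \<le> ennreal (4 * exp L * (real N / 2 + 1)\<^sup>2) * (\<integral>\<^sup>+x. ennreal (exp (\<phi> x)) \<partial>std_gaussian) ^ N"
proof -
  have \<phi>_m[measurable]: "\<phi> \<in> borel_measurable borel"
    using L by (intro borel_measurable_continuous_onI lipschitz_on_continuous_on)
  define F where "F w = ennreal (exp (\<Sum>i<N. \<phi> (w i)))" for w :: "nat \<Rightarrow> real"
  define G where "G v = F (radial_projection N v)" for v
  define X where "X = (\<integral>\<^sup>+x. ennreal (exp (\<phi> x)) \<partial>std_gaussian)"
  define q where "q = sqrt (2 * pi * exp 1)"
  define s where "s = sqrt (real N)"
  have s: "0 < s" using N by (simp add: s_def)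
  have F_m[measurable]: "F \<in> borel_measurable (borel_Rn N)" unfolding F_def borel_Rn_def by measurable
  have G_m[measurable]: "G \<in> borel_measurable (borel_Rn N)" unfolding G_def by measurable
  let ?S = "{v \<in> unit_ball_Rn N. 1 - 1 / real N < L2_set v {..<N}}"
  have S_eq: "?S = {v \<in> space (borel_Rn N). L2_set v {..<N} \<le> 1 \<and> 1 - 1 / real N < L2_set v {..<N}}"
    by (auto simp: unit_ball_Rn_def)
  have [measurable]: "?S \<in> sets (borel_Rn N)" unfolding S_eq by measurable
  have G_le: "G v \<le> ennreal (exp (real N * K))" for v
  proof -
    have "(\<Sum>i<N. \<phi> (radial_projection N v i)) \<le> (\<Sum>i<N. K)"
      by (rule sum_mono) (rule abs_le_D1[OF K])
    then show ?thesis by (simp add: G_def F_def ennreal_leI)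
  qed
  have "(\<integral>\<^sup>+v. G v * indicator (unit_ball_Rn N) v \<partial>lborel_Rn N)
      \<le> 2 * (\<integral>\<^sup>+v. G v * indicator ?S v \<partial>lborel_Rn N)"
    by (rule nn_integral_ball_le_shell[OF N G_m G_le]) (simp add: G_def radial_projection_restrict_scale)
  also have "(\<integral>\<^sup>+v. G v * indicator ?S v \<partial>lborel_Rn N) = ennreal ((1 / s) ^ N) *
      (\<integral>\<^sup>+v. G (\<lambda>i\<in>{..<N}. 1 / s * v i) * indicator ?S (\<lambda>i\<in>{..<N}. 1 / s * v i) \<partial>lborel_Rn N)"
    by (rule nn_integral_lborel_Rn_scale) (use s in auto)
  also have "(\<integral>\<^sup>+v. G (\<lambda>i\<in>{..<N}. 1 / s * v i) * indicator ?S (\<lambda>i\<in>{..<N}. 1 / s * v i) \<partial>lborel_Rn N)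
      \<le> (\<integral>\<^sup>+v. ennreal (exp L) * (F v * indicator {v. L2_set v {..<N} \<le> sqrt (real N)} v) \<partial>lborel_Rn N)"
  proof (rule nn_integral_mono)
    fix v
    show "G (\<lambda>i\<in>{..<N}. 1 / s * v i) * indicator ?S (\<lambda>i\<in>{..<N}. 1 / s * v i)
      \<le> ennreal (exp L) * (F v * indicator {v. L2_set v {..<N} \<le> sqrt (real N)} v)"
    proof (cases "(\<lambda>i\<in>{..<N}. 1 / s * v i) \<in> ?S")
      case True
      then have "1 / s * L2_set v {..<N} \<le> 1" "1 - 1 / real N < 1 / s * L2_set v {..<N}"
        using s L2_set_restrict_scale[where r = "1 / s" and v = v and N = N] by (auto simp: unit_ball_Rn_def)
      then have v: "L2_set v {..<N} \<le> sqrt (real N)" "(1 - 1 / real N) * sqrt (real N) < L2_set v {..<N}"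
        using s by (auto simp: s_def[symmetric] field_simps)
      have "G (\<lambda>i\<in>{..<N}. 1 / s * v i) = G v"
        using s by (simp add: G_def radial_projection_restrict_scale del: times_divide_eq_left)
      also have "\<dots> \<le> ennreal (exp ((\<Sum>i<N. \<phi> (v i)) + L))"
        unfolding G_def F_def using sum_radial_projection_le[OF L N v(2,1)] by (intro ennreal_leI) simp
      also have "\<dots> = ennreal (exp L) * F v"
        by (simp add: F_def exp_add ennreal_mult'[symmetric] mult.commute)
      finally show ?thesis using True v by simp
    qed simp
  qed
  also have "\<dots> = ennreal (exp L) * (\<integral>\<^sup>+v. F v * indicator {v. L2_set v {..<N} \<le> sqrt (real N)} v \<partial>lborel_Rn N)"
  proof (rule nn_integral_cmult)
    show "(\<lambda>v. F v * indicator {v. L2_set v {..<N} \<le> sqrt (real N)} v) \<in> borel_measurable (lborel_Rn N)"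
      unfolding measurable_cong_sets[OF sets_lborel_Rn refl] by measurable
  qed
  also have "\<dots> \<le> ennreal (exp L) * (ennreal q * X) ^ N"
    unfolding F_def X_def q_def by (intro mult_left_mono nn_integral_ball_le_gaussian) auto
  finally have "(\<integral>\<^sup>+v. G v * indicator (unit_ball_Rn N) v \<partial>lborel_Rn N)
      \<le> 2 * (ennreal ((1 / s) ^ N) * (ennreal (exp L) * (ennreal q * X) ^ N))"
    by (simp add: mult_left_mono)
  also have "\<dots> = (2 * ennreal (exp L) * (ennreal ((1 / s) ^ N) * ennreal (q ^ N))) * X ^ N"
    by (simp add: q_def power_mult_distrib ennreal_power mult_ac)
  also have "2 * ennreal (exp L) * (ennreal ((1 / s) ^ N) * ennreal (q ^ N)) = ennreal (2 * exp L * (q / s) ^ N)"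
    using s by (simp add: q_def power_divide ennreal_mult'[symmetric] flip: ennreal_numeral)
  finally have J: "(\<integral>\<^sup>+v. G v * indicator (unit_ball_Rn N) v \<partial>lborel_Rn N)
      \<le> ennreal (2 * exp L * (q / s) ^ N) * X ^ N" .
  have "(\<integral>\<^sup>+w. F w \<partial>sphere_uniform N)
      \<le> (\<integral>\<^sup>+v. G v * indicator (unit_ball_Rn N) v \<partial>lborel_Rn N) / ennreal (unit_ball_vol (real N))"
    unfolding G_def by (rule nn_integral_sphere_uniform_le[OF F_m])
  also have "\<dots> \<le> (ennreal (2 * exp L * (q / s) ^ N) * X ^ N) / ennreal (unit_ball_vol (real N))"
    by (rule divide_right_mono_ennreal[OF J])
  also have "\<dots> = ennreal (2 * exp L * (q / s) ^ N / unit_ball_vol (real N)) * X ^ N"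
  proof -
    have "(a * x) / b = (a / b) * x" for a x b :: ennreal by (simp add: divide_ennreal_def mult_ac)
    then show ?thesis using s by (simp add: divide_ennreal q_def)
  qed
  also have "\<dots> \<le> ennreal (4 * exp L * (real N / 2 + 1)\<^sup>2) * X ^ N"
  proof (intro mult_right_mono ennreal_leI)
    have "2 * exp L * (q / s) ^ N / unit_ball_vol (real N) = 2 * exp L * (q ^ N / (s ^ N * unit_ball_vol (real N)))"
      by (simp add: power_divide)
    also have "\<dots> \<le> 2 * exp L * (2 * (real N / 2 + 1)\<^sup>2)"
      unfolding q_def s_def using N by (intro mult_left_mono inverse_unit_ball_vol_le) auto
    finally show "2 * exp L * (q / s) ^ N / unit_ball_vol (real N) \<le> 4 * exp L * (real N / 2 + 1)\<^sup>2" by simp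
  qed simp
  finally show ?thesis by (simp add: F_def X_def)
qed

section \<open>Entropy and chaos\<close>

lemma prob_space_std_gaussian: "prob_space std_gaussian"
proof -
  have "std_gaussian = density lborel (\<lambda>x. ennreal (std_normal_density x))"
    unfolding std_gaussian_def by (simp add: std_normal_density_def)
  then show ?thesis using prob_space_normal_density[of 1 0] by simp
qed

lemma borel_measurable_borel_kac_sphere:
  assumes "sets M = sets (borel_kac_sphere N)" "f \<in> borel_Rn N \<rightarrow>\<^sub>M K"
  shows "f \<in> M \<rightarrow>\<^sub>M K"
  using assms(2) unfolding measurable_cong_sets[OF assms(1) refl] borel_kac_sphere_def
  by (rule measurable_restrict_space1)

lemma measurable_permute_kac_sphere:
  assumes p: "p permutes {..<N}" and M: "sets M = sets (borel_kac_sphere N)"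
  shows "(\<lambda>v. v \<circ> p) \<in> M \<rightarrow>\<^sub>M M"
proof -
  have "(\<lambda>v. \<lambda>i\<in>{..<N}. v (p i)) \<in> borel_Rn N \<rightarrow>\<^sub>M borel_Rn N"
    unfolding borel_Rn_def using permutes_in_image[OF p] by (intro measurable_restrict measurable_component_singleton) auto
  moreover have ext: "(\<lambda>i\<in>{..<N}. v (p i)) = v \<circ> p" if "v \<in> space (borel_Rn N)" for v
    using that p by (auto simp: borel_Rn_def space_PiM PiE_iff extensional_def permutes_def fun_eq_iff)
  ultimately have R: "(\<lambda>v. v \<circ> p) \<in> borel_Rn N \<rightarrow>\<^sub>M borel_Rn N"
    using measurable_cong[of "borel_Rn N" "\<lambda>v. \<lambda>i\<in>{..<N}. v (p i)" "\<lambda>v. v \<circ> p"] by blast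
  have "L2_set (v \<circ> p) {..<N} = L2_set v {..<N}" for v :: "nat \<Rightarrow> real"
    unfolding L2_set_def using sum.permute[OF p, of "\<lambda>i. (v i)\<^sup>2"] by (simp add: o_def)
  then have "(\<lambda>v. v \<circ> p) \<in> kac_sphere N \<rightarrow> kac_sphere N"
    using measurable_space[OF R] by (auto simp: kac_sphere_def)
  then have "(\<lambda>v. v \<circ> p) \<in> borel_kac_sphere N \<rightarrow>\<^sub>M borel_kac_sphere N"
    unfolding borel_kac_sphere_def
    by (intro measurable_restrict_space2 measurable_restrict_space1 R) (auto simp: space_restrict_space)
  then show ?thesis using measurable_cong_sets[OF M M] by blast
qed

lemma symmetric_measure_integral_coordinate:
  assumes sym: "symmetric_measure N M" and M: "sets M = sets (borel_kac_sphere N)"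
    and [measurable]: "\<phi> \<in> borel_measurable borel" and i: "i < N"
  shows "(\<integral>v. \<phi> (v i) \<partial>M) = (\<integral>v. (\<phi> (v 0) :: real) \<partial>M)"
proof -
  define p where "p = Transposition.transpose 0 i"
  have p: "p permutes {..<N}" unfolding p_def using i by (intro permutes_swap_id) auto
  have eq: "distr M M (\<lambda>v. v \<circ> p) = M" using sym p by (simp add: symmetric_measure_def)
  have "(\<lambda>v. \<phi> (v 0)) \<in> borel_measurable (borel_Rn N)"
    unfolding borel_Rn_def using i
    by (intro measurable_compose[OF measurable_component_singleton]) auto
  then have m: "(\<lambda>v. \<phi> (v 0)) \<in> borel_measurable M" by (rule borel_measurable_borel_kac_sphere[OF M])
  have "(\<integral>v. \<phi> (v 0) \<partial>M) = (\<integral>v. \<phi> (v 0) \<partial>distr M M (\<lambda>v. v \<circ> p))" by (simp add: eq)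
  also have "\<dots> = (\<integral>v. \<phi> ((v \<circ> p) 0) \<partial>M)"
    by (rule integral_distr[OF measurable_permute_kac_sphere[OF p M] m])
  finally show ?thesis by (simp add: p_def)
qed

text \<open>
  The variational lower bound for the test function $v \mapsto \sum_i \varphi(v_i)$. Its mean is \<open>N\<close> times
  the mean of $\varphi(v_0)$ by symmetry, and its Laplace transform is controlled by a product of Gaussian
  ones. The last subtracted term comes from the polynomial factor and vanishes as $N \to \infty$.
\<close>

lemma relative_entropy_sphere_ge:
  assumes "prob_space M" and M: "sets M = sets (borel_kac_sphere N)" and sym: "symmetric_measure N M"
    and L: "L-lipschitz_on UNIV \<phi>" and K: "\<And>x. \<bar>\<phi> x\<bar> \<le> K" and N: "2 \<le> N"
  shows "ereal ((\<integral>v. \<phi> (v 0) \<partial>M) - ln (\<integral>x. exp (\<phi> x) \<partial>std_gaussian)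
      - ln (4 * exp L * (real N / 2 + 1)\<^sup>2) / real N)
    \<le> relative_entropy M (sphere_uniform N) / ereal (real N)"
proof -
  interpret M: prob_space M by fact
  interpret S: prob_space "sphere_uniform N" by (rule prob_space_sphere_uniform) (use N in simp)
  interpret G: prob_space std_gaussian by (rule prob_space_std_gaussian)
  have \<phi>_m[measurable]: "\<phi> \<in> borel_measurable borel"
    using L by (intro borel_measurable_continuous_onI lipschitz_on_continuous_on)
  define \<Phi> where "\<Phi> w = (\<Sum>i<N. \<phi> (w i))" for w :: "nat \<Rightarrow> real"
  have "\<Phi> \<in> borel_measurable (borel_Rn N)" unfolding \<Phi>_def borel_Rn_def by measurable
  then have [measurable]: "\<Phi> \<in> borel_measurable (sphere_uniform N)"
    by (rule borel_measurable_borel_kac_sphere[OF sets_sphere_uniform])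
  have \<Phi>_bound: "\<bar>\<Phi> w\<bar> \<le> real N * K" for w
  proof -
    have "\<bar>\<Phi> w\<bar> \<le> (\<Sum>i<N. \<bar>\<phi> (w i)\<bar>)" unfolding \<Phi>_def by (rule sum_abs)
    also have "\<dots> \<le> (\<Sum>i<N. K)" by (intro sum_mono K)
    finally show ?thesis by simp
  qed
  define X where "X = (\<integral>x. exp (\<phi> x) \<partial>std_gaussian)"
  define Z where "Z = (\<integral>w. exp (\<Phi> w) \<partial>sphere_uniform N)"
  define P where "P = 4 * exp L * (real N / 2 + 1)\<^sup>2"
  have P: "0 < P" by (simp add: P_def add_nonneg_pos)
  have iX: "integrable std_gaussian (\<lambda>x. exp (\<phi> x))"
    by (rule G.integrable_const_bound[where B = "exp K"])
      (use abs_le_D1[OF K] in \<open>auto simp: std_gaussian_def\<close>)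
  have "exp (- K) = (\<integral>x. exp (- K) \<partial>std_gaussian)" using G.prob_space by simp
  also have "\<dots> \<le> X"
    unfolding X_def using abs_le_D2[OF K] iX by (intro integral_mono) (auto simp: minus_le_iff)
  finally have X: "0 < X" by (rule less_le_trans[OF exp_gt_zero])
  have iZ: "integrable (sphere_uniform N) (\<lambda>w. exp (\<Phi> w))"
    by (rule S.integrable_const_bound[where B = "exp (real N * K)"])
      (use abs_le_D1[OF \<Phi>_bound] in auto)
  have "exp (- (real N * K)) = (\<integral>x. exp (- (real N * K)) \<partial>sphere_uniform N)" using S.prob_space by simp
  also have "\<dots> \<le> Z"
    unfolding Z_def using abs_le_D2[OF \<Phi>_bound] iZ by (intro integral_mono) (auto simp: minus_le_iff)
  finally have Z: "0 < Z" by (rule less_le_trans[OF exp_gt_zero])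
  have "ennreal Z = (\<integral>\<^sup>+w. ennreal (exp (\<Phi> w)) \<partial>sphere_uniform N)"
    unfolding Z_def by (rule nn_integral_eq_integral[symmetric]) (use iZ in auto)
  also have "\<dots> \<le> ennreal P * (\<integral>\<^sup>+x. ennreal (exp (\<phi> x)) \<partial>std_gaussian) ^ N"
    unfolding \<Phi>_def P_def by (rule sphere_laplace_le_gaussian[OF L K N])
  also have "(\<integral>\<^sup>+x. ennreal (exp (\<phi> x)) \<partial>std_gaussian) = ennreal X"
    unfolding X_def by (rule nn_integral_eq_integral) (use iX in auto)
  also have "ennreal P * ennreal X ^ N = ennreal (P * X ^ N)"
    using P X by (simp add: ennreal_power ennreal_mult)
  finally have "Z \<le> P * X ^ N" using P X by (simp add: ennreal_le_iff)
  then have "ln Z \<le> ln (P * X ^ N)" using Z by (intro ln_mono) auto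
  also have "\<dots> = ln P + real N * ln X" using P X by (simp add: ln_mult_pos ln_realpow)
  finally have lnZ: "ln Z \<le> ln P + real N * ln X" .
  have "(\<integral>w. \<Phi> w \<partial>M) = (\<Sum>i<N. \<integral>w. \<phi> (w i) \<partial>M)"
    unfolding \<Phi>_def
  proof (rule Bochner_Integration.integral_sum)
    fix i assume "i \<in> {..<N}"
    then have "(\<lambda>w. \<phi> (w i)) \<in> borel_measurable (borel_Rn N)" unfolding borel_Rn_def by measurable
    then have "(\<lambda>w. \<phi> (w i)) \<in> borel_measurable M" by (rule borel_measurable_borel_kac_sphere[OF M])
    then show "integrable M (\<lambda>w. \<phi> (w i))" using K by (intro M.integrable_const_bound[where B = K]) auto
  qed
  also have "\<dots> = (\<Sum>i<N. \<integral>w. \<phi> (w 0) \<partial>M)"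
    by (intro sum.cong refl symmetric_measure_integral_coordinate[OF sym M \<phi>_m]) simp
  also have "\<dots> = real N * (\<integral>w. \<phi> (w 0) \<partial>M)" by simp
  finally have "real N * ((\<integral>w. \<phi> (w 0) \<partial>M) - ln X - ln P / real N) \<le> (\<integral>w. \<Phi> w \<partial>M) - ln Z"
    using lnZ N by (simp add: right_diff_distrib)
  then have "ereal (real N * ((\<integral>w. \<phi> (w 0) \<partial>M) - ln X - ln P / real N)) \<le> ereal ((\<integral>w. \<Phi> w \<partial>M) - ln Z)"
    by simp
  also have "\<dots> \<le> relative_entropy M (sphere_uniform N)"
    unfolding Z_def using M \<Phi>_bound
    by (intro relative_entropy_ge_Donsker_Varadhan[where K = "real N * K"] M.prob_space_axioms S.prob_space_axioms)
      (auto simp: sets_sphere_uniform)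
  finally show ?thesis
    unfolding X_def[symmetric] P_def[symmetric] using N by (subst ereal_le_divide_pos) auto
qed

lemma chaotic_integral_coordinate_tendsto:
  assumes \<mu>: "prob_space \<mu>" and sets: "sets \<mu> = sets borel"
    and Ms: "\<And>N. 1 \<le> N \<Longrightarrow> sets (\<mu>s N) = sets (borel_kac_sphere N)"
    and chaotic: "chaotic \<mu> \<mu>s"
    and cont: "continuous_on UNIV \<phi>" and K: "\<And>x. \<bar>\<phi> x\<bar> \<le> K"
  shows "(\<lambda>N. \<integral>v. \<phi> (v 0) \<partial>\<mu>s N) \<longlonglongrightarrow> (\<integral>x. (\<phi> x :: real) \<partial>\<mu>)"
proof -
  interpret M: prob_space \<mu> by fact
  have \<phi>_m[measurable]: "\<phi> \<in> borel_measurable borel" using cont by (rule borel_measurable_continuous_onI)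
  let ?f = "\<lambda>v::nat \<Rightarrow> real. \<phi> (v 0)"
  have "continuous_map euclideanreal euclideanreal \<phi>" using cont by simp
  then have "continuous_map (powertop_real {..<1::nat}) euclideanreal (\<phi> \<circ> (\<lambda>v. v 0))"
    by (intro continuous_map_compose[OF continuous_map_product_projection]) auto
  moreover have "bounded (?f ` topspace (powertop_real {..<1}))"
    using K by (intro boundedI[of _ K]) auto
  ultimately have lim: "(\<lambda>N. \<integral>v. ?f v \<partial>marginal 1 (\<mu>s N)) \<longlonglongrightarrow> (\<integral>v. ?f v \<partial>(\<Pi>\<^sub>M i\<in>{..<1}. \<mu>))"
    using chaotic unfolding chaotic_def weakly_converges_Rn_def o_def by blast
  have "\<forall>\<^sub>F N in sequentially. (\<integral>v. ?f v \<partial>marginal 1 (\<mu>s N)) = (\<integral>v. ?f v \<partial>\<mu>s N)"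
    using eventually_ge_at_top[of 1]
  proof eventually_elim
    case (elim N)
    have "(\<lambda>v. restrict v {..<1}) \<in> borel_Rn N \<rightarrow>\<^sub>M borel_Rn 1"
      unfolding borel_Rn_def by (rule measurable_restrict_subset) (use elim in auto)
    then have r: "(\<lambda>v. restrict v {..<1}) \<in> \<mu>s N \<rightarrow>\<^sub>M borel_Rn 1"
      by (rule borel_measurable_borel_kac_sphere[OF Ms[OF elim]])
    have "?f \<in> borel_measurable (borel_Rn 1)" unfolding borel_Rn_def by measurable
    then show ?case unfolding marginal_def by (subst integral_distr[OF r]) auto
  qed
  moreover have "(\<integral>v. ?f v \<partial>(\<Pi>\<^sub>M i\<in>{..<1}. \<mu>)) = (\<integral>x. \<phi> x \<partial>\<mu>)"
  proof -
    interpret product_sigma_finite "\<lambda>_::nat. \<mu>" by standard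
    have "\<phi> \<in> borel_measurable \<mu>" using \<phi>_m measurable_cong_sets[OF sets refl] by blast
    moreover have "{..<1} = {0::nat}" by auto
    ultimately show ?thesis using product_integral_singleton[of \<phi> 0] by simp
  qed
  ultimately show ?thesis using lim by (simp add: tendsto_cong)
qed

theorem theorem12:
  fixes \<mu> :: "real measure" and \<mu>s :: "nat \<Rightarrow> (nat \<Rightarrow> real) measure"
  assumes "prob_space \<mu>" and "sets \<mu> = sets borel"
    and "\<And>N. N \<ge> 1 \<Longrightarrow> prob_space (\<mu>s N)"
    and "\<And>N. N \<ge> 1 \<Longrightarrow> sets (\<mu>s N) = sets (borel_kac_sphere N)"
    and "chaotic \<mu> \<mu>s"
  shows "relative_entropy \<mu> std_gaussian
           \<le> liminf (\<lambda>N. relative_entropy (\<mu>s N) (sphere_uniform N) / ereal (real N))"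
    (is "_ \<le> ?l")
proof -
  interpret M: prob_space \<mu> by fact
  interpret G: prob_space std_gaussian by (rule prob_space_std_gaussian)
  have dual: "ereal ((\<integral>x. g x \<partial>\<mu>) - ln (\<integral>x. exp (g x) \<partial>std_gaussian)) \<le> ?l"
    if g: "bounded_lipschitz g" for g
  proof -
    obtain L K where L: "L-lipschitz_on UNIV g" and K: "\<And>x. \<bar>g x\<bar> \<le> K"
      using g unfolding bounded_lipschitz_def by blast
    define a where "a N = (\<integral>v. g (v 0) \<partial>\<mu>s N) - ln (\<integral>x. exp (g x) \<partial>std_gaussian)
      - ln (4 * exp L * (real N / 2 + 1)\<^sup>2) / real N" for N
    have "(\<lambda>N. ln (4 * exp L * (real N / 2 + 1)\<^sup>2) / real N) \<longlonglongrightarrow> 0" by real_asymp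
    then have "a \<longlonglongrightarrow> (\<integral>x. g x \<partial>\<mu>) - ln (\<integral>x. exp (g x) \<partial>std_gaussian) - 0"
      unfolding a_def
      by (intro tendsto_diff tendsto_const
          chaotic_integral_coordinate_tendsto[OF assms(1,2,4,5) lipschitz_on_continuous_on[OF L] K])
    then have "(\<lambda>N. ereal (a N)) \<longlonglongrightarrow> ereal ((\<integral>x. g x \<partial>\<mu>) - ln (\<integral>x. exp (g x) \<partial>std_gaussian))" by simp
    then have "ereal ((\<integral>x. g x \<partial>\<mu>) - ln (\<integral>x. exp (g x) \<partial>std_gaussian)) = liminf (\<lambda>N. ereal (a N))"
      by (rule lim_imp_Liminf[OF sequentially_bot, symmetric])
    also have "\<dots> \<le> ?l"
    proof (rule Liminf_mono)
      show "\<forall>\<^sub>F N in sequentially. ereal (a N) \<le> relative_entropy (\<mu>s N) (sphere_uniform N) / ereal (real N)"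
        using eventually_ge_at_top[of 2]
      proof eventually_elim
        case (elim N)
        then show ?case
          unfolding a_def using assms(3-5)
          by (intro relative_entropy_sphere_ge[OF _ _ _ L K]) (auto simp: chaotic_def)
      qed
    qed
    finally show ?thesis .
  qed
  \<comment> \<open>The test function \<open>0\<close> excludes the value \<open>- \<infinity>\<close>.\<close>
  have "0 \<le> ?l" using dual[OF bounded_lipschitz_const[of 0]] G.prob_space by (simp add: zero_ereal_def)
  then consider "?l = \<infinity>" | c where "?l = ereal c" by (cases ?l) auto
  then show ?thesis
  proof cases
    case 2
    have "relative_entropy \<mu> std_gaussian \<le> ereal c"
    proof (rule relative_entropy_le_bounded_lipschitz[OF assms(1) G.prob_space_axioms assms(2)])
      show "sets std_gaussian = sets borel" by (simp add: std_gaussian_def)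
      show "(\<integral>x. g x \<partial>\<mu>) - ln (\<integral>x. exp (g x) \<partial>std_gaussian) \<le> c" if "bounded_lipschitz g" for g
        using dual[OF that] 2 by simp
    qed
    then show ?thesis by (simp add: 2)
  qed simp
qed

end
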